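(* For every real $c$ with $0<c<1/2$ and every real $c_1$ with $0<c_1\leqslant 1$, one has, for all sufficiently large $x$ and all integers $k$ with $1\leqslant k\leqslant \frac{\log_2 x}{\log_4 x}$, $$\#\{n\leqslant x:\phi_{k+1}(n)\geqslant c n\}\leqslant \frac{6}{(k-1)!\,e^{(k-1)\gamma}\pi^2}\cdot \frac{x}{c(\log_3 x)^{k+1}}+O\left(\frac{x\exp\left\{(\log_3 x)^2\right\}}{(\log x)^{c_1}(\log_3 x)^2}\right),$$ where the implied constant does not depend on $x$ or $k$ (it may depend on $c$ and $c_1$).
   Context: $\phi$ denotes the Euler totient function on positive integers, $\phi(n)=n\prod_{p\mid n}(1-1/p)$, and $\phi_k$ denotes its $k$-fold iterate: $\phi_1=\phi$ and $\phi_{k+1}(n)=\phi(\phi_k(n))$. In the set $\{n\leqslant x: \ldots\}$, $n$ runs over positive integers. $\log_k$ denotes the $k$-fold iterated natural logarithm, $\log_k x=\log\log\cdots\log x$ ($k$ times), not a logarithm to base $k$. $\gamma=0.57721\ldots$ is the Euler–Mascheroni constant. *)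

theory Defs
  imports
    "HOL-Number_Theory.Totient"
    "HOL-Analysis.Harmonic_Numbers"
begin

definition totient_iter :: "nat \<Rightarrow> nat \<Rightarrow> nat" where
  "totient_iter k n = (totient ^^ k) n"

(* Only meaningful where all intermediate values are positive, i.e. for x large in terms of k. *)
definition ln_iter :: "nat \<Rightarrow> real \<Rightarrow> real" where
  "ln_iter k x = (ln ^^ k) x"

end

theory Submission
  imports
    Defs
    "HOL-Analysis.Analysis"
    "HOL-Number_Theory.Number_Theory"
    "HOL-Real_Asymp.Real_Asymp"
begin

text \<open>
  Iterated totients lose a factor 2 at every step after the first one until they reach 1, so
  \<open>totient_iter (k + 1) n \<ge> c * n\<close> forces \<open>2 ^ k \<le> 1 / c\<close> or \<open>n \<le> 1 / c\<close>. Hence only boundedly many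
  \<open>k\<close> matter, and for each of them the main term, which is \<open>x\<close> divided by a fixed power of
  \<open>ln (ln (ln x))\<close>, already dominates. Indeed, choose \<open>Q\<close> such that the product of \<open>1 - 1 / r\<close> over
  the odd primes \<open>r \<le> Q\<close> is less than \<open>c\<close>. If the second iterate is at least \<open>c
      * n\<close>, then some prime
  \<open>q \<le> Q\<close> does not divide \<open>totient n\<close>, and so \<open>n\<close> has no prime factor congruent to 1 modulo \<open>q\<close>.
  By the Legendre sieve with the primes up to \<open>ln x\<close> and a quantitative form of Dirichlet's theorem
  for the residue class 1, there are only \<open>O(x / (ln (ln x)) ^ \<delta>)\<close> such \<open>n \<le> x\<close>.

  For the quantitative Dirichlet theorem, the Euler products over \<open>p \<le> y\<close> of all characters modulo
  \<open>q\<close> are evaluated at the real point \<open>s = 1 + 1 / sqrt (ln y)\<close>. This \<open>s\<close> is so far from 1 that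
  trivial bounds control the tails, and the loss is only in the exponent \<open>\<delta>\<close>.
\<close>

section \<open>Dirichlet characters modulo a prime\<close>

text \<open>\<open>w\<close> generates the group of Dirichlet characters modulo \<open>q\<close>,
  each extended by 0 to the multiples of \<open>q\<close>. By \<open>w_eq_1_iff\<close> the single
  value \<open>w p\<close> decides whether \<open>p\<close> is 1 modulo \<open>q\<close>;
  \<open>w_power_nontrivial\<close> says that no positive power below the exponent
  \<open>q - 1\<close> is principal.\<close>

locale prime_character_generator =
  fixes q :: nat and w :: "nat \<Rightarrow> complex"
  assumes prime_q: "prime q"
    and w_mult: "w (m * n) = w m * w n"
    and w_eq_0_iff: "w n = 0 \<longleftrightarrow> q dvd n"
    and w_mod: "w (n mod q) = w n"
    and w_root: "\<not> q dvd n \<Longrightarrow> w n ^ (q - 1) = 1"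
    and w_eq_1_iff: "w n = 1 \<longleftrightarrow> [n = 1] (mod q)"
    and w_power_nontrivial: "0 < j \<Longrightarrow> j < q - 1 \<Longrightarrow> \<exists>g. \<not> q dvd g \<and> w g ^ j \<noteq> 1"

text \<open>Fix a primitive root \<open>g\<close> and send \<open>g ^ i\<close> to the root of unity
  with angle \<open>2 * pi * i / (q - 1)\<close>.\<close>

lemma prime_character_generator_exists:
  assumes q: "prime q"
  shows "\<exists>w. prime_character_generator q w"
proof -
  obtain g where g: "residue_primroot q g"
    using prime_primitive_root_exists[of q] q prime_gt_1_nat by auto
  define N where "N = q - 1"
  have q1: "q > 1" using q prime_gt_1_nat by auto
  then have N: "N > 0" by (simp add: N_def)
  have ordg: "ord q g = N" and cop: "coprime q g"
    using g q by (auto simp: residue_primroot_def totient_prime N_def)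
  \<comment> \<open>A discrete logarithm to base \<open>g\<close>. Being an exponent of
    \<open>g\<close>, it matters only modulo \<open>N\<close>, and \<open>e\<close> has period
    \<open>N\<close>.\<close>
  define ind where "ind n = (SOME i. [g ^ i = n] (mod q))" for n
  have ind: "[g ^ ind n = n] (mod q)" if "\<not> q dvd n" for n
  proof -
    have "coprime n q"
      using q that by (meson coprime_commute prime_imp_coprime)
    then have "coprime (n mod q) q" using q1 by simp
    then have "n mod q \<in> totatives q"
      using q1 that by (auto simp: totatives_def dvd_eq_mod_eq_0 intro: less_imp_le)
    then have "n mod q \<in> (\<lambda>i. g ^ i mod q) ` {..<totient q}"
      using bij_betw_imp_surj_on[OF residue_primroot_is_generator[OF q1 g]] by simp
    then obtain i where "n mod q = g ^ i mod q" by (rule imageE)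
    then have "g ^ i mod q = n mod q" by simp
    then show ?thesis unfolding ind_def by (metis (mono_tags, lifting) Cong.cong_def someI_ex)
  qed
  define e where "e i = cis (2 * pi * real i / real N)" for i
  have e_add: "e (i + j) = e i * e j" for i j
    by (simp add: e_def cis_mult add_divide_distrib distrib_left)
  have e_eq_1: "e i = 1 \<longleftrightarrow> N dvd i" for i
  proof
    assume "N dvd i"
    then obtain k where "i = N * k" by auto
    then have "e i = cis (2 * pi * real k)" using N by (simp add: e_def field_simps)
    then show "e i = 1" by (simp add: cis_multiple_2pi)
  next
    assume "e i = 1"
    then have "cos (2 * pi * real i / real N) = 1" by (simp add: e_def complex_eq_iff)
    then obtain k :: int where "2 * pi * real i / real N = of_int k * 2 * pi"
      using cos_one_2pi_int by auto
    then have "real i = of_int k * real N" using N by (simp add: field_simps)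
    then have "int i = k * int N"
      by (metis of_int_eq_iff of_int_mult of_int_of_nat_eq)
    then show "N dvd i" by (metis dvd_triv_right int_dvd_int_iff)
  qed
  have e_cong: "e i = e j" if "[i = j] (mod N)" for i j
  proof -
    have "e a = e (a mod N)" for a
    proof -
      have "a = (a div N * N) + a mod N" by simp
      then have "e a = e (a div N * N) * e (a mod N)" using e_add by metis
      moreover have "e (a div N * N) = 1" using e_eq_1 by simp
      ultimately show ?thesis by simp
    qed
    then show ?thesis using that unfolding Cong.cong_def by metis
  qed
  have e_nz: "e i \<noteq> 0" for i by (simp add: e_def)
  have e_0: "e 0 = 1" by (simp add: e_def)
  have e_pow: "e i ^ k = e (k * i)" for i k
    by (induction k) (simp_all add: e_0 e_add)
  define w where "w n = (if q dvd n then 0 else e (ind n))" for n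
  have w_pow: "w (g ^ i) = e i" for i
  proof -
    have nd: "\<not> q dvd g ^ i"
      using cop q by (metis coprime_absorb_left not_prime_unit prime_dvd_power_nat)
    from ind[OF nd] have "[ind (g ^ i) = i] (mod N)"
      using order_divides_expdiff[OF cop] ordg by simp
    then show ?thesis using nd e_cong by (simp add: w_def)
  qed
  have w_cong: "w m = w n" if "[m = n] (mod q)" for m n
  proof -
    have "q dvd m \<longleftrightarrow> q dvd n" using that by (simp add: cong_dvd_iff)
    \<comment> \<open>For congruent arguments both choices are made from the same set of exponents,
      so they agree exactly and not merely modulo \<open>N\<close>.\<close>
    moreover have "ind m = ind n" unfolding ind_def using that
      by (metis cong_sym cong_trans)
    ultimately show ?thesis by (simp add: w_def)
  qed
  have "prime_character_generator q w"
  proof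
    show "prime q" by fact
    show "w (m * n) = w m * w n" for m n
    proof (cases "q dvd m \<or> q dvd n")
      case True
      then show ?thesis by (auto simp: w_def)
    next
      case False
      then have "w (m * n) = w (g ^ ind m * g ^ ind n)"
        by (intro w_cong) (metis cong_mult cong_sym ind)
      also have "\<dots> = e (ind m) * e (ind n)" by (metis w_pow power_add e_add)
      finally show ?thesis using False by (simp add: w_def)
    qed
    show "w n = 0 \<longleftrightarrow> q dvd n" for n by (simp add: w_def e_nz)
    show "w (n mod q) = w n" for n by (rule w_cong) simp
    show "w n ^ (q - 1) = 1" if "\<not> q dvd n" for n
      using that e_pow e_eq_1 by (simp add: w_def N_def)
    show "w n = 1 \<longleftrightarrow> [n = 1] (mod q)" for n
    proof
      assume "[n = 1] (mod q)"
      then have "w n = w (g ^ 0)" by (intro w_cong) simp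
      then show "w n = 1" using w_pow[of 0] e_eq_1[of 0] by simp
    next
      assume 1: "w n = 1"
      then have nd: "\<not> q dvd n" by (auto simp: w_def)
      then have "N dvd ind n" using 1 e_eq_1 by (simp add: w_def)
      then have "[g ^ ind n = 1] (mod q)" using ord_divides ordg by blast
      then show "[n = 1] (mod q)" using ind[OF nd] cong_sym cong_trans by blast
    qed
    show "\<exists>g. \<not> q dvd g \<and> w g ^ j \<noteq> 1" if "0 < j" "j < q - 1" for j
    proof (intro exI conjI)
      have nd: "\<not> q dvd g ^ 1"
        using cop q by (metis coprime_absorb_left not_prime_unit prime_dvd_power_nat)
      then show "\<not> q dvd g" by simp
      have "w g ^ j = e j" using w_pow[of 1] e_pow[of 1 j] by simp
      then show "w g ^ j \<noteq> 1" using e_eq_1 that nat_dvd_not_less by (auto simp: N_def)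
    qed
  qed
  then show ?thesis by blast
qed

context prime_character_generator
begin

lemma q_gt_1: "q > 1"
  using prime_q prime_gt_1_nat by auto

lemma w_1: "w 1 = 1"
  using w_eq_1_iff[of 1] by simp

lemma norm_w_le: "norm (w n) \<le> 1"
proof (cases "q dvd n")
  case False
  then have "norm (w n) ^ (q - 1) = 1" by (metis norm_one norm_power w_root)
  then show ?thesis using power_eq_1_iff[of "norm (w n)" "q-1"] q_gt_1 by force
next
  case True
  then show ?thesis using w_eq_0_iff[of n] by simp
qed

text \<open>Multiplication by a suitable \<open>g\<close> permutes the residues and multiplies the
  sum by \<open>w g ^ j\<close>, which is not 1.\<close>

lemma sum_w_power_eq_0:
  assumes j: "0 < j" "j < q - 1"
  shows "(\<Sum>a<q. w a ^ j) = 0"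
proof -
  obtain g where g: "\<not> q dvd g" "w g ^ j \<noteq> 1" using w_power_nontrivial j by blast
  have inj: "inj_on (\<lambda>a. g * a mod q) {..<q}"
  proof (rule inj_onI)
    fix a b assume ab: "a \<in> {..<q}" "b \<in> {..<q}" "g * a mod q = g * b mod q"
    have "coprime g q" using g(1) prime_q by (meson coprime_commute prime_imp_coprime)
    then have "[a = b] (mod q)" using ab(3) cong_mult_lcancel_nat[of g q a b]
        by (auto simp: Cong.cong_def)
    then show "a = b" using ab by (simp add: Cong.cong_def)
  qed
  have "(\<lambda>a. g * a mod q) ` {..<q} = {..<q}"
    by (rule card_subset_eq) (use inj q_gt_1 in \<open>auto simp: card_image\<close>)
  then have bij: "bij_betw (\<lambda>a. g * a mod q) {..<q} {..<q}"
    using inj by (simp add: bij_betw_def)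
  have "(\<Sum>a<q. w a ^ j) = (\<Sum>a<q. w (g * a mod q) ^ j)"
    using sum.reindex_bij_betw[OF bij, of "\<lambda>a. w a ^ j"] by simp
  also have "\<dots> = (\<Sum>a<q. w g ^ j * w a ^ j)"
    by (simp only: w_mod w_mult power_mult_distrib)
  also have "\<dots> = w g ^ j * (\<Sum>a<q. w a ^ j)" by (simp add: sum_distrib_left)
  finally show ?thesis using g(2) by simp
qed

text \<open>Full periods cancel, and fewer than \<open>q\<close> terms of norm at most 1 remain.
  These bounded partial sums are what summation by parts needs.\<close>

lemma norm_sum_w_power_le:
  assumes j: "0 < j" "j < q - 1"
  shows "norm (\<Sum>a<n. w a ^ j) \<le> q"
proof -
  have per: "(\<Sum>a<m * q + r. w a ^ j) = (\<Sum>a<r. w a ^ j)" for m r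
  proof (induction m)
    case (Suc m)
    have "(\<Sum>a<Suc m * q + r. w a ^ j) = (\<Sum>a<q. w a ^ j) + (\<Sum>a = q..<q + (m * q + r). w a ^ j)"
      by (subst sum.atLeastLessThan_concat[symmetric, of 0 q, simplified
          lessThan_atLeast0[symmetric]])
        (auto simp: algebra_simps lessThan_atLeast0)
    also have "(\<Sum>a = q..<q + (m * q + r). w a ^ j) = (\<Sum>a<m * q + r. w (a + q) ^ j)"
      using sum.shift_bounds_nat_ivl[of "\<lambda>a. w a ^ j" 0 q "m * q + r"]
      by (simp add: lessThan_atLeast0 add.commute)
    also have "\<dots> = (\<Sum>a<m * q + r. w a ^ j)"
      by (intro sum.cong refl arg_cong[where f = "\<lambda>z. z ^ j"]) (metis mod_add_self2 w_mod)
    finally show ?case using Suc sum_w_power_eq_0[OF j] by simp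
  qed simp
  have "(\<Sum>a<n. w a ^ j) = (\<Sum>a<n mod q. w a ^ j)"
    using per[of "n div q" "n mod q"] by simp
  also have "norm \<dots> \<le> (\<Sum>a<n mod q. norm (w a ^ j))" by (rule norm_sum)
  also have "\<dots> \<le> (\<Sum>a<n mod q. 1)"
    by (intro sum_mono) (simp add: norm_power norm_w_le power_le_one)
  also have "\<dots> \<le> q" using q_gt_1 by (simp add: less_imp_le)
  finally show ?thesis by simp
qed

end

section \<open>Euler products and summation by parts\<close>

text \<open>Adding a prime \<open>p\<close> to \<open>P\<close> removes the multiples of
  \<open>p\<close> from the index set \<open>C\<close>. They form the image of \<open>C\<close>
  under multiplication by \<open>p\<close>, so their sum is \<open>f p\<close> times the sum over
  \<open>C\<close>.\<close>

lemma infsum_coprime_eq_prod: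
  fixes f :: "nat \<Rightarrow> complex"
  assumes f_mult: "\<And>m n. f (m * n) = f m * f n" and sm: "f summable_on UNIV"
    and P: "finite P" "\<And>p. p \<in> P \<Longrightarrow> prime p"
  shows "infsum f {n. \<forall>p\<in>P. \<not> p dvd n} = (\<Prod>p\<in>P. 1 - f p) * infsum f UNIV"
  using P
proof (induction P rule: finite_induct)
  case empty
  then show ?case by simp
next
  case (insert p P)
  define C where "C = {n. \<forall>p\<in>P. \<not> p dvd n}"
  have p: "prime p" using insert by auto
  have sub: "(\<lambda>n. p * n) ` C \<subseteq> C"
  proof (intro image_subsetI)
    fix n assume n: "n \<in> C"
    have "\<not> r dvd p * n" if r: "r \<in> P" for r
    proof
      assume "r dvd p * n"
      then have "r dvd p \<or> r dvd n" using insert.prems r by (simp add: prime_dvd_mult_iff)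
      moreover have "r \<noteq> p" using r insert.hyps by auto
      ultimately show False using n r insert.prems p by (auto simp: C_def primes_dvd_imp_eq)
    qed
    then show "p * n \<in> C" by (simp add: C_def)
  qed
  have eq: "{n. \<forall>r\<in>insert p P. \<not> r dvd n} = C - (\<lambda>n. p * n) ` C"
  proof (intro equalityI subsetI)
    fix n assume "n \<in> {n. \<forall>r\<in>insert p P. \<not> r dvd n}"
    then show "n \<in> C - (\<lambda>n. p * n) ` C" by (auto simp: C_def)
  next
    fix n assume n: "n \<in> C - (\<lambda>n. p * n) ` C"
    have "\<not> p dvd n"
    proof
      assume "p dvd n"
      then obtain m where m: "n = p * m" by auto
      then have "m \<in> C" using n by (auto simp: C_def)
      then show False using n m by auto
    qed
    then show "n \<in> {n. \<forall>r\<in>insert p P. \<not> r dvd n}" using n by (auto simp: C_def)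
  qed
  have sC: "f summable_on C" "f summable_on (\<lambda>n. p * n) ` C"
    using sm by (auto intro: summable_on_subset_banach)
  have "infsum f ((\<lambda>n. p * n) ` C) = infsum (f \<circ> (\<lambda>n. p * n)) C"
    by (rule infsum_reindex) (use p in \<open>auto intro: inj_onI simp: prime_gt_0_nat\<close>)
  also have "\<dots> = (\<Sum>\<^sub>\<infinity>n\<in>C. f p * f n)" by (simp add: o_def f_mult)
  also have "\<dots> = f p * infsum f C" by (simp add: infsum_cmult_right')
  finally have "infsum f {n. \<forall>r\<in>insert p P. \<not> r dvd n} = (1 - f p) * infsum f C"
    unfolding eq using infsum_Diff[OF sC sub] by (simp add: algebra_simps)
  then show ?case using insert by (simp add: C_def)
qed

text \<open>An integer above 1 without prime factors up to \<open>y\<close> exceeds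
  \<open>y\<close>, so apart from the term at 1 only the tail survives.\<close>

lemma norm_infsum_coprime_minus_1_le:
  fixes f :: "nat \<Rightarrow> complex"
  assumes f1: "f 1 = 1" and f0: "f 0 = 0" and sm: "(\<lambda>n. norm (f n)) summable_on UNIV"
    and y: "y \<ge> 1"
  shows "norm (infsum f {n. \<forall>p\<in>{p. prime p \<and> p \<le> y}. \<not> p dvd n} - 1) \<le> (\<Sum>\<^sub>\<infinity>n\<in>{y<..}. norm (f n))"
proof -
  define C where "C = {n. \<forall>p\<in>{p. prime p \<and> p \<le> y}. \<not> p dvd n}"
  have C: "C \<subseteq> insert 0 (insert 1 {y<..})"
  proof
    fix n assume n: "n \<in> C"
    show "n \<in> insert 0 (insert 1 {y<..})"
    proof (rule ccontr)
      assume c: "n \<notin> insert 0 (insert 1 {y<..})"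
      then have "n \<noteq> 1" by auto
      then obtain p where p: "prime p" "p dvd n" using prime_factor_nat by blast
      then have "p \<le> n" using c by (auto intro: dvd_imp_le)
      then show False using n p c by (auto simp: C_def)
    qed
  qed
  have 1: "1 \<in> C" by (auto simp: C_def)
  have sf: "f summable_on A" for A
    using abs_summable_summable[OF sm] by (rule summable_on_subset_banach) simp
  have sn: "(\<lambda>n. norm (f n)) summable_on A" for A
    using sm by (rule summable_on_subset_banach) simp
  have "infsum f C = infsum f (insert 1 (C - {1}))"
    using 1 by (simp add: insert_absorb)
  also have "\<dots> = f 1 + infsum f (C - {1})"
    by (intro infsum_insert sf) auto
  finally have "norm (infsum f C - 1) = norm (infsum f (C - {1}))"
    using f1 by simp
  also have "\<dots> \<le> (\<Sum>\<^sub>\<infinity>n\<in>C - {1}. norm (f n))"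
    by (intro norm_infsum_bound sn)
  also have "\<dots> \<le> (\<Sum>\<^sub>\<infinity>n\<in>{y<..}. norm (f n))"
    by (intro infsum_mono_neutral sn) (use C f0 in auto)
  finally show ?thesis by (simp add: C_def)
qed

section \<open>Sums of \<open>n powr - s\<close> by comparison with an integral\<close>

text \<open>The mean value theorem for \<open>x powr (1 - s)\<close>. Summed over \<open>n\<close>,
  the differences telescope, which gives the integral test without integrals.\<close>

lemma powr_diff_bounds:
  fixes s :: real
  assumes s: "s > 1" and n: "n \<ge> 1"
  shows "(s - 1) * real (Suc n) powr - s \<le> real n powr (1 - s) - real (Suc n) powr (1 - s)"
    and "real n powr (1 - s) - real (Suc n) powr (1 - s) \<le> (s - 1) * real n powr - s"
proof -
  have "\<exists>z. real n < z \<and> z < real (Suc n) \<and>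
      real (Suc n) powr (1 - s) - real n powr (1 - s)
          = (real (Suc n) - real n) * ((1 - s) * z powr (- s))"
  proof (rule MVT2)
    fix x assume "real n \<le> x" "x \<le> real (Suc n)"
    then have "x > 0" using n by simp
    then show "((\<lambda>x. x powr (1 - s)) has_real_derivative ((1 - s) * x powr (- s))) (at x)"
      by (auto intro!: derivative_eq_intros)
  qed simp
  then obtain z where z: "real n < z" "z < real (Suc n)"
    and eq: "real n powr (1 - s) - real (Suc n) powr (1 - s) = (s - 1) * z powr (- s)"
    by (auto simp: algebra_simps)
  have "real (Suc n) powr - s \<le> z powr (-s)" "z powr (-s) \<le> real n powr (-s)"
    using z n s by (auto intro!: powr_mono2')
  then show "(s - 1) * real (Suc n) powr - s \<le> real n powr (1 - s) - real (Suc n) powr (1 - s)"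
    and "real n powr (1 - s) - real (Suc n) powr (1 - s) \<le> (s - 1) * real n powr - s"
    unfolding eq using s by (auto intro: mult_left_mono)
qed

lemma powr_sum_le:
  fixes s :: real
  assumes s: "s > 1" and y: "y \<ge> 1" and F: "finite F" "F \<subseteq> {y<..}"
  shows "(\<Sum>n\<in>F. real n powr - s) \<le> real y powr (1 - s) / (s - 1)"
proof -
  have *: "(s - 1) * (\<Sum>n\<in>{y<..y+k}. real n powr - s)
      \<le> real y powr (1 - s) - real (y + k) powr (1 - s)" for k
  proof (induction k)
    case (Suc k)
    have "{y<..y + Suc k} = insert (Suc (y + k)) {y<..y + k}" by auto
    then have "(s - 1) * (\<Sum>n\<in>{y<..y + Suc k}. real n powr - s) =
        (s - 1) * (\<Sum>n\<in>{y<..y + k}. real n powr - s) + (s - 1) * real (Suc (y + k)) powr - s"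
      by (simp add: algebra_simps)
    then show ?case using Suc powr_diff_bounds(1)[OF s, of "y + k"] y by simp
  qed simp
  obtain k where "F \<subseteq> {y<..y+k}"
  proof -
    obtain m where m: "\<forall>n\<in>F. n \<le> m" using F(1) finite_nat_set_iff_bounded_le by auto
    then have "F \<subseteq> {y<..y+m}" using F(2) by fastforce
    then show ?thesis using that by blast
  qed
  then have "(\<Sum>n\<in>F. real n powr - s) \<le> (\<Sum>n\<in>{y<..y+k}. real n powr - s)"
    by (intro sum_mono2) auto
  then have "(s - 1) * (\<Sum>n\<in>F. real n powr - s) \<le> (s - 1) * (\<Sum>n\<in>{y<..y+k}. real n powr - s)"
    using s by (intro mult_left_mono) auto
  also have "\<dots> \<le> real y powr (1 - s)" using *[of k] powr_ge_zero[of "real (y + k)" "1 - s"]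
      by linarith
  finally show ?thesis using s by (simp add: field_simps)
qed

lemma powr_summable_on:
  fixes s :: real
  assumes s: "s > 1"
  shows "(\<lambda>n. real n powr - s) summable_on A"
proof -
  have "(\<lambda>n. real n powr - s) summable_on {1<..}"
    by (intro nonneg_bdd_above_summable_on bdd_aboveI2[where M = "real 1 powr (1 - s) / (s - 1)"])
      (use powr_sum_le[OF s, of 1] in auto)
  then have "(\<lambda>n. real n powr - s) summable_on insert 0 (insert 1 {1<..})"
    by (simp only: summable_on_insert_iff)
  moreover have "insert 0 (insert 1 {1<..}) = (UNIV :: nat set)" by auto
  ultimately show ?thesis using summable_on_subset_banach by (metis top_greatest)
qed

lemma infsum_powr_tail_le:
  fixes s :: real
  assumes s: "s > 1" and y: "y \<ge> 1"
  shows "(\<Sum>\<^sub>\<infinity>n\<in>{y<..}. real n powr - s) \<le> real y powr (1 - s) / (s - 1)"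
  by (intro infsum_le_finite_sums powr_summable_on s powr_sum_le y)

text \<open>These bounds pin down the simple pole of the zeta function at 1. The index 0 contributes
  nothing, since \<open>0 powr - s\<close> is 0.\<close>

lemma infsum_powr_bounds:
  fixes s :: real
  assumes s: "s > 1"
  shows "(\<Sum>\<^sub>\<infinity>n. real n powr - s) \<le> 1 + 1 / (s - 1)"
    and "1 / (s - 1) \<le> (\<Sum>\<^sub>\<infinity>n. real n powr - s)"
proof -
  have "(UNIV :: nat set) = {0, 1} \<union> {1<..}" by auto
  then have "(\<Sum>\<^sub>\<infinity>n. real n powr - s) = (\<Sum>\<^sub>\<infinity>n\<in>{0, 1} \<union> {1<..}. real n powr - s)" by simp
  also have "\<dots> = 1 + (\<Sum>\<^sub>\<infinity>n\<in>{1<..}. real n powr - s)"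
    by (subst infsum_Un_disjoint) (auto intro: powr_summable_on s)
  finally show "(\<Sum>\<^sub>\<infinity>n. real n powr - s) \<le> 1 + 1 / (s - 1)"
    using infsum_powr_tail_le[OF s, of 1] by simp
  have "1 - real (Suc k) powr (1 - s) \<le> (s - 1) * (\<Sum>\<^sub>\<infinity>n. real n powr - s)" for k
  proof -
    have "1 - real (Suc k) powr (1 - s) \<le> (s - 1) * (\<Sum>n\<in>{1..k}. real n powr - s)"
    proof (induction k)
      case (Suc k)
      then show ?case using powr_diff_bounds(2)[OF s, of "Suc k"]
        by (simp add: algebra_simps)
    qed simp
    also have "\<dots> \<le> (s - 1) * (\<Sum>\<^sub>\<infinity>n. real n powr - s)"
      using s by (intro mult_left_mono finite_sum_le_infsum powr_summable_on) auto
    finally show ?thesis .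
  qed
  moreover have "(\<lambda>k. 1 - real (Suc k) powr (1 - s)) \<longlonglongrightarrow> 1 - 0"
  proof (intro tendsto_diff tendsto_const)
    have "(\<lambda>k. real k powr (1 - s)) \<longlonglongrightarrow> 0"
      using s by (intro tendsto_neg_powr filterlim_real_sequentially) auto
    then show "(\<lambda>k. real (Suc k) powr (1 - s)) \<longlonglongrightarrow> 0" by (rule LIMSEQ_Suc)
  qed
  ultimately have "1 \<le> (s - 1) * (\<Sum>\<^sub>\<infinity>n. real n powr - s)"
    by (intro LIMSEQ_le_const2[where X = "\<lambda>k. 1 - real (Suc k) powr (1 - s)"]) auto
  then show "1 / (s - 1) \<le> (\<Sum>\<^sub>\<infinity>n. real n powr - s)" using s by (simp add: field_simps)
qed

text \<open>Summation by parts moves the differences onto \<open>a\<close>; the boundary term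
  vanishes because the partial sums of \<open>u\<close> are bounded and \<open>a\<close> tends to
  0.\<close>

lemma Abel_bound:
  fixes u :: "nat \<Rightarrow> complex" and a :: "nat \<Rightarrow> real"
  assumes u: "\<And>n. norm (\<Sum>i<n. u i) \<le> B"
    and a0: "a \<longlonglongrightarrow> 0" and sm: "summable (\<lambda>n. \<bar>a n - a (Suc n)\<bar>)"
  shows "summable (\<lambda>n. u n * a n)"
    and "norm (\<Sum>n. u n * a n) \<le> B * (\<Sum>n. \<bar>a n - a (Suc n)\<bar>)"
proof -
  define U where "U n = (\<Sum>i<n. u i)" for n
  have part: "(\<Sum>i<n. u i * a i) = U n * a n + (\<Sum>i<n. U (Suc i) * (a i - a (Suc i)))" for n
    by (induction n) (simp_all add: U_def algebra_simps)
  have bd: "norm (U (Suc i) * (a i - a (Suc i))) \<le> B * \<bar>a i - a (Suc i)\<bar>" for i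
  proof -
    have "norm (U (Suc i)) * \<bar>a i - a (Suc i)\<bar> \<le> B * \<bar>a i - a (Suc i)\<bar>"
      using u[of "Suc i"] by (intro mult_right_mono) (simp_all add: U_def)
    then show ?thesis by (metis norm_mult norm_of_real of_real_diff)
  qed
  have smB: "summable (\<lambda>n. B * \<bar>a n - a (Suc n)\<bar>)" using sm by (rule summable_mult)
  then have smU: "summable (\<lambda>i. norm (U (Suc i) * (a i - a (Suc i))))"
    using bd by (intro summable_comparison_test[OF _ smB]) auto
  have "(\<lambda>n. U n * a n) \<longlonglongrightarrow> 0"
  proof (rule Lim_null_comparison)
    show "\<forall>\<^sub>F n in sequentially. norm (U n * a n) \<le> B * \<bar>a n\<bar>"
      using u by (intro always_eventually allI) (auto simp: U_def norm_mult intro!: mult_right_mono)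
    show "(\<lambda>n. B * \<bar>a n\<bar>) \<longlonglongrightarrow> 0" using a0
      by (intro tendsto_mult_right_zero tendsto_rabs_zero)
  qed
  moreover have "(\<lambda>n. \<Sum>i<n. U (Suc i) * (a i - a (Suc i))) \<longlonglongrightarrow> (\<Sum>i. U (Suc i) * (a i - a (Suc i)))"
    using summable_norm_cancel[OF smU] by (rule summable_LIMSEQ)
  ultimately have "(\<lambda>n. \<Sum>i<n. u i * a i) \<longlonglongrightarrow> 0 + (\<Sum>i. U (Suc i) * (a i - a (Suc i)))"
    unfolding part by (rule tendsto_add)
  then have sums: "(\<lambda>n. u n * a n) sums (\<Sum>i. U (Suc i) * (a i - a (Suc i)))"
    by (simp add: sums_def)
  then show "summable (\<lambda>n. u n * a n)" by (rule sums_summable)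
  have "norm (\<Sum>i. U (Suc i) * (a i - a (Suc i))) \<le> (\<Sum>i. norm (U (Suc i) * (a i - a (Suc i))))"
    by (rule summable_norm[OF smU])
  also have "\<dots> \<le> (\<Sum>i. B * \<bar>a i - a (Suc i)\<bar>)"
    by (intro suminf_le bd smU smB)
  also have "\<dots> = B * (\<Sum>n. \<bar>a n - a (Suc n)\<bar>)" using sm by (rule suminf_mult)
  finally show "norm (\<Sum>n. u n * a n) \<le> B * (\<Sum>n. \<bar>a n - a (Suc n)\<bar>)"
    using sums by (simp add: sums_iff)
qed

section \<open>Products over the powers of a root of unity\<close>

text \<open>Expand each \<open>ln (1 - z ^ j * t)\<close> as a power series and take real parts.
  Summing over \<open>j\<close> first leaves only the exponents \<open>n\<close> with
  \<open>z ^ n = 1\<close>. This is the local factor of all characters together at a prime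
  \<open>p\<close>, with \<open>z = w p\<close> and \<open>t = p powr - s\<close>.\<close>

lemma root_of_unity_product_sums:
  fixes z :: complex and t :: real
  assumes z: "z ^ N = 1" and N: "N > 0" and t: "0 \<le> t" "t < 1"
  shows "(\<lambda>n. - (if z ^ n = 1 then real N else 0) * t ^ n / real n) sums
           ln (norm (\<Prod>j\<in>{1..N}. 1 - z ^ j * t))"
    and "norm (\<Prod>j\<in>{1..N}. 1 - z ^ j * t) > 0"
proof -
  have nz: "norm z = 1"
    using z N by (metis norm_ge_zero norm_one norm_power power_eq_1_iff not_gr_zero)
  have nt: "norm (- (z ^ j * complex_of_real t)) < 1" for j
    using t nz by (simp add: norm_mult norm_power)
  have ne: "1 - z ^ j * complex_of_real t \<noteq> 0" for j
    using nt[of j] by (metis eq_iff_diff_eq_0 norm_minus_cancel norm_one less_irrefl)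
  have "(\<lambda>n. - ((z ^ j * t) ^ n) / of_nat n) sums ln (1 - z ^ j * t)" for j
    using Ln_series'[OF nt[of j]] by simp
  then have "(\<lambda>n. \<Sum>j\<in>{1..N}. - ((z ^ j * t) ^ n) / of_nat n) sums (\<Sum>j\<in>{1..N}. ln (1 - z ^ j * t))"
    by (intro sums_sum) auto
  then have sR: "(\<lambda>n. Re (\<Sum>j\<in>{1..N}. - ((z ^ j * t) ^ n) / of_nat n))
      sums Re (\<Sum>j\<in>{1..N}. ln (1 - z ^ j * t))"
    by (rule sums_Re)
  have sum_root: "(\<Sum>j\<in>{1..N}. (z ^ n) ^ j) = (if z ^ n = 1 then of_nat N else 0)" for n
  proof (cases "z ^ n = 1")
    case False
    have "z ^ n * (\<Sum>j\<in>{1..N}. (z ^ n) ^ j) = (\<Sum>j\<in>{1..N}. (z ^ n) ^ j)"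
    proof -
      have "(z ^ n) ^ Suc N = z ^ n" using z
          by (simp add: power_commutes flip: power_mult) (simp add: power_mult mult.commute[of n])
      moreover have "z ^ n * (\<Sum>j\<in>{1..N}. (z ^ n) ^ j) = (\<Sum>j\<in>{1..N}. (z ^ n) ^ Suc j)"
        by (simp add: sum_distrib_left)
      moreover have "(\<Sum>j\<in>{1..N}. (z ^ n) ^ Suc j)
          = (\<Sum>j\<in>{1..N}. (z ^ n) ^ j) + (z ^ n) ^ Suc N - (z ^ n) ^ 1"
        by (induction N) auto
      ultimately show ?thesis by simp
    qed
    then show ?thesis using False by auto
  qed simp
  have coeff: "Re (\<Sum>j\<in>{1..N}. - ((z ^ j * t) ^ n) / of_nat n) =
      - (if z ^ n = 1 then real N else 0) * t ^ n / real n" for n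
  proof -
    have "(\<Sum>j\<in>{1..N}. - ((z ^ j * t) ^ n) / of_nat n)
        = - (\<Sum>j\<in>{1..N}. (z ^ n) ^ j) * complex_of_real (t ^ n / real n)"
      by (simp add: sum_distrib_right sum_negf sum_divide_distrib power_mult_distrib
          power_mult[symmetric] mult.commute[of n])
    then show ?thesis unfolding sum_root by (auto simp: Re_divide_of_nat)
  qed
  have "Re (\<Sum>j\<in>{1..N}. ln (1 - z ^ j * t)) = (\<Sum>j\<in>{1..N}. ln (norm (1 - z ^ j * t)))"
    using ne by (simp add: Re_Ln)
  also have "\<dots> = ln (norm (\<Prod>j\<in>{1..N}. 1 - z ^ j * t))"
    by (subst prod_norm[symmetric], subst ln_prod) (use ne in auto)
  finally show "(\<lambda>n. - (if z ^ n = 1 then real N else 0) * t ^ n / real n) sums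
           ln (norm (\<Prod>j\<in>{1..N}. 1 - z ^ j * t))"
    using sR unfolding coeff by simp
  show "norm (\<Prod>j\<in>{1..N}. 1 - z ^ j * t) > 0" using ne by simp
qed

text \<open>Every coefficient in the series for the logarithm is nonpositive.\<close>

lemma root_of_unity_product_le_1:
  fixes z :: complex and t :: real
  assumes z: "z ^ N = 1" and N: "N > 0" and t: "0 \<le> t" "t < 1"
  shows "norm (\<Prod>j\<in>{1..N}. 1 - z ^ j * t) \<le> 1"
proof -
  note s = root_of_unity_product_sums[OF assms]
  have "ln (norm (\<Prod>j\<in>{1..N}. 1 - z ^ j * t)) \<le> 0"
    by (rule sums_le[OF _ s(1) sums_zero]) (use t in auto)
  then show ?thesis using s(2) by (simp add: ln_le_zero_iff)
qed

text \<open>As \<open>z\<close> is not 1, the linear term of the logarithm is absent, so the loss is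
  only quadratic in \<open>t\<close>. For \<open>t = p powr - s\<close> it is therefore summable
  over all primes, uniformly in \<open>s > 1\<close>.\<close>

lemma root_of_unity_product_ge:
  fixes z :: complex and t :: real
  assumes z: "z ^ N = 1" "z \<noteq> 1" and N: "N > 0" and t: "0 \<le> t" "t \<le> 1 / 2"
  shows "exp (- (real N * t\<^sup>2)) \<le> norm (\<Prod>j\<in>{1..N}. 1 - z ^ j * t)"
proof -
  have t1: "t < 1" using t by simp
  note s = root_of_unity_product_sums[OF z(1) N t(1) t1]
  \<comment> \<open>A geometric minorant: for \<open>n \<ge> 2\<close> the coefficient
    \<open>1 / n\<close> is replaced by \<open>1 / 2\<close>, and every such \<open>z ^ n\<close> is
    treated as 1.\<close>
  define g where "g n = (if n < 2 then 0 else - (real N / 2) * t ^ n)" for n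
  have "(\<lambda>n. t ^ n) sums (1 / (1 - t))"
    using t by (intro geometric_sums) auto
  then have "(\<lambda>n. (- (real N / 2) * t\<^sup>2) * t ^ n) sums ((- (real N / 2) * t\<^sup>2) * (1 / (1 - t)))"
    by (rule sums_mult)
  moreover have "(\<lambda>n. (- (real N / 2) * t\<^sup>2) * t ^ n) = (\<lambda>n. g (n + 2))"
    by (rule ext) (simp add: g_def power_add power2_eq_square)
  ultimately have "g sums (- (real N / 2) * t\<^sup>2 * (1 / (1 - t)) + (\<Sum>i<2. g i))"
    using sums_iff_shift[of g 2] by simp
  then have g: "g sums (- (real N / 2) * t\<^sup>2 * (1 / (1 - t)))"
    by (simp add: g_def numeral_2_eq_2)
  have "- (real N / 2) * t\<^sup>2 * (1 / (1 - t)) \<le> ln (norm (\<Prod>j\<in>{1..N}. 1 - z ^ j * t))"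
  proof (rule sums_le[OF _ g s(1)])
    fix n
    show "g n \<le> - (if z ^ n = 1 then real N else 0) * t ^ n / real n"
    proof (cases "n < 2")
      case True
      \<comment> \<open>For \<open>n = 0\<close> division by zero gives 0, and for
        \<open>n = 1\<close> the condition \<open>z ^ n = 1\<close> fails.\<close>
      then have "n = 0 \<or> n = 1" by auto
      then show ?thesis using z(2) by (auto simp: g_def)
    next
      case False
      then have "t ^ n / real n \<le> t ^ n / 2" using t by (intro divide_left_mono) auto
      then have "real N * (t ^ n / real n) \<le> real N * (t ^ n / 2)" by (intro mult_left_mono) auto
      then show ?thesis using False t by (auto simp: g_def)
    qed
  qed
  moreover have "real N * t\<^sup>2 \<ge> (real N / 2) * t\<^sup>2 * (1 / (1 - t))"
  proof -
    have "1 / (1 - t) \<le> 2" using t by (simp add: field_simps)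
    then have "(real N / 2 * t\<^sup>2) * (1 / (1 - t)) \<le> (real N / 2 * t\<^sup>2) * 2"
      by (intro mult_left_mono) auto
    then show ?thesis by simp
  qed
  ultimately have "- (real N * t\<^sup>2) \<le> ln (norm (\<Prod>j\<in>{1..N}. 1 - z ^ j * t))" by simp
  then show ?thesis using s(2) by (simp add: ln_ge_iff)
qed

text \<open>The nonvanishing at 1 for real characters is Monsky's argument: the Lambert series of the
  character stays bounded near 1 if \<open>L(1)\<close> vanishes, yet its power series coefficients
  are nonnegative and at least 1 at squares.\<close>

lemma divisor_sum_prime_power:
  fixes X :: "nat \<Rightarrow> real"
  assumes mult: "\<And>m n. X (m * n) = X m * X n"
    and p: "prime p" "\<not> p dvd m" and m: "m > 0"
  shows "(\<Sum>d | d dvd p ^ Suc k * m. X d) = (\<Sum>d | d dvd m. X d) + X p * (\<Sum>d | d dvd p ^ k * m. X d)"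
proof -
  have p0: "p > 0" using p by (simp add: prime_gt_0_nat)
  have eq: "{d. d dvd p ^ Suc k * m} = {d. d dvd m} \<union> (\<lambda>d. p * d) ` {d. d dvd p ^ k * m}"
  proof (intro equalityI subsetI)
    fix d assume d: "d \<in> {d. d dvd p ^ Suc k * m}"
    show "d \<in> {d. d dvd m} \<union> (\<lambda>d. p * d) ` {d. d dvd p ^ k * m}"
    proof (cases "p dvd d")
      case True
      then obtain e where "d = p * e" by auto
      then show ?thesis using d p0 by (auto simp: mult.assoc)
    next
      case False
      then have "coprime d (p ^ Suc k)"
        using p(1) by (meson coprime_commute coprime_power_right_iff prime_imp_coprime)
      then show ?thesis using d by (simp add: coprime_dvd_mult_right_iff)
    qed
  qed (auto simp: mult.assoc)
  have "(\<Sum>d | d dvd p ^ Suc k * m. X d) = (\<Sum>d | d dvd m. X d) + (\<Sum>d\<in>(\<lambda>d. p * d) ` {d. d dvd p ^ k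
      * m}. X d)"
    unfolding eq by (rule sum.union_disjoint) (use p m p0 in \<open>auto dest: dvd_mult_left\<close>)
  also have "(\<Sum>d\<in>(\<lambda>d. p * d) ` {d. d dvd p ^ k * m}. X d) = (\<Sum>d | d dvd p ^ k * m. X (p * d))"
    by (subst sum.reindex) (use p0 in \<open>auto intro: inj_onI\<close>)
  finally show ?thesis by (simp add: mult sum_distrib_left)
qed

text \<open>Split off the full power of one prime \<open>p\<close>. The sums \<open>r i\<close>
  satisfy \<open>r (Suc i) = r 0 + X p * r i\<close>: if \<open>X p\<close> is -1 they alternate
  between \<open>r 0\<close> and 0, otherwise they are at least \<open>r 0\<close>. At even
  exponents, the only ones in a square, they are at least \<open>r 0\<close> in every case.\<close>

lemma divisor_sum_nonneg:
  fixes X :: "nat \<Rightarrow> real"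
  assumes mult: "\<And>m n. X (m * n) = X m * X n" and one: "X 1 = 1"
    and vals: "\<And>n. X n \<in> {-1, 0, 1}"
  shows "n > 0 \<Longrightarrow> (\<Sum>d | d dvd n. X d) \<ge> 0 \<and> ((\<exists>a. n = a\<^sup>2) \<longrightarrow> (\<Sum>d | d dvd n. X d) \<ge> 1)"
proof (induction n rule: less_induct)
  case (less n)
  show ?case
  proof (cases "n = 1")
    case True
    then show ?thesis using one by simp
  next
    case False
    then obtain p where p: "prime p" "p dvd n" using prime_factor_nat by blast
    define k where "k = multiplicity p n"
    have nu: "\<not> is_unit p" using p(1) not_prime_unit by blast
    obtain m where m: "n = p ^ k * m" "\<not> p dvd m"
      by (rule multiplicity_decompose'[of n p]) (use less.prems nu k_def in auto)
    have k: "k > 0" using p less.prems by (simp add: k_def prime_multiplicity_gt_zero_iff)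
    have m0: "m > 0" using m less.prems by (cases m) auto
    have "1 < p ^ k" using one_less_power[OF prime_gt_1_nat[OF p(1)] k] .
    then have "m < n" using m m0 by simp
    note IH = less.IH[OF this m0]
    define r where "r i = (\<Sum>d | d dvd p ^ i * m. X d)" for i
    have rS: "r (Suc i) = r 0 + X p * r i" for i
      unfolding r_def by (subst divisor_sum_prime_power[OF mult p(1) m(2) m0]) simp_all
    have r0: "r 0 \<ge> 0" using IH by (simp add: r_def)
    have "r i \<ge> 0 \<and> r i \<le> r 0" if "X p = -1" for i
      by (induction i) (use r0 rS that in auto)
    moreover have "r i \<ge> r 0" if "X p \<in> {0, 1}" for i
      using that r0 by (induction i) (auto simp: rS)
    ultimately have nonneg: "r i \<ge> 0" for i
      using vals[of p] r0 by (metis insert_iff order_trans singletonD)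
    have even: "r (2 * i) \<ge> r 0" for i
    proof (induction i)
      case (Suc i)
      have "r (2 * Suc i) = r 0 + X p * (r 0 + X p * r (2 * i))" by (simp add: rS)
      then show ?case using vals[of p] Suc nonneg[of "2*i"] r0 by auto
    qed simp
    have "r k \<ge> 1" if n: "n = a\<^sup>2" for a
    proof -
      have a0: "a \<noteq> 0" using n less.prems by auto
      define l where "l = multiplicity p a"
      obtain b where b: "a = p ^ l * b" "\<not> p dvd b"
        by (rule multiplicity_decompose'[of a p]) (use a0 nu l_def in auto)
      have kl: "k = 2 * l"
        using a0 p(1) unfolding k_def l_def n by (subst prime_elem_multiplicity_power_distrib) auto
      have "p ^ k * m = p ^ k * b\<^sup>2"
        unfolding m(1)[symmetric] n by (subst b(1)) (simp add: kl power_mult_distrib mult.commute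
            flip: power_mult)
      moreover have "p \<noteq> 0" using p(1) by auto
      ultimately have "m = b\<^sup>2" by simp
      then have "r 0 \<ge> 1" using IH by (auto simp: r_def)
      then show ?thesis using even[of l] kl by simp
    qed
    then show ?thesis using nonneg[of k] m(1) by (auto simp: r_def)
  qed
qed

section \<open>The Lambert series of a real character\<close>

text \<open>The inequality of arithmetic and geometric means, applied to each pair
  \<open>x ^ i\<close> and \<open>x ^ (n - Suc i)\<close>.\<close>

lemma geometric_sum_ge:
  fixes x :: real
  assumes "0 < x"
  shows "real n * sqrt (x ^ (n - 1)) \<le> (\<Sum>i<n. x ^ i)"
proof -
  have "(\<Sum>i<n. sqrt (x ^ (n - 1))) \<le> (\<Sum>i<n. (x ^ i + x ^ (n - Suc i)) / 2)"
  proof (rule sum_mono)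
    fix i assume i: "i \<in> {..<n}"
    have "sqrt (x ^ i * x ^ (n - Suc i)) \<le> (x ^ i + x ^ (n - Suc i)) / 2"
      using assms by (intro arith_geo_mean_sqrt) auto
    then show "sqrt (x ^ (n - 1)) \<le> (x ^ i + x ^ (n - Suc i)) / 2"
      using i by (simp flip: power_add)
  qed
  also have "\<dots> = (\<Sum>i<n. x ^ i)"
    by (simp add: sum.distrib sum.nat_diff_reindex flip: sum_divide_distrib)
  finally show ?thesis by simp
qed

text \<open>Writing \<open>1 - x ^ n\<close> as \<open>(1 - x) * S n\<close> reduces the claim to
  \<open>n * (n + 1) * x ^ n \<le> S n * S (Suc n)\<close>, which follows from two uses of
  \<open>geometric_sum_ge\<close>.\<close>

lemma Lambert_difference_decreasing:
  fixes x :: real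
  assumes x: "0 < x" "x < 1" and n: "n \<ge> 1"
  shows "1 / (real (Suc n) * (1 - x)) - x ^ Suc n / (1 - x ^ Suc n)
       \<le> 1 / (real n * (1 - x)) - x ^ n / (1 - x ^ n)"
proof -
  define S where "S n = (\<Sum>i<n. x ^ i)" for n
  have S: "1 - x ^ n = (1 - x) * S n" for n
    by (simp add: S_def one_diff_power_eq)
  have pos: "S n > 0" if "n \<ge> 1" for n
    unfolding S_def using x that by (intro sum_pos) (auto simp: lessThan_empty_iff)
  have S1: "S (Suc n) = 1 + x * S n"
    unfolding S_def sum.lessThan_Suc_shift by (simp add: sum_distrib_left)
  have "real n * sqrt (x ^ (n - 1)) * (real (Suc n) * sqrt (x ^ n)) \<le> S n * S (Suc n)"
    using geometric_sum_ge[OF x(1), of n] geometric_sum_ge[OF x(1), of "Suc n"] pos[OF n] x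
    by (intro mult_mono) (auto simp: S_def)
  moreover have "x ^ n \<le> sqrt (x ^ (n - 1)) * sqrt (x ^ n)"
  proof -
    have "x ^ n = sqrt (x ^ n * x ^ n)" using x by simp
    also have "\<dots> \<le> sqrt (x ^ (n - 1) * x ^ n)"
      using x by (intro real_sqrt_le_mono mult_right_mono power_decreasing) auto
    finally show ?thesis by (simp add: real_sqrt_mult)
  qed
  then have "real n * real (Suc n) * x ^ n
      \<le> real n * real (Suc n) * (sqrt (x ^ (n - 1)) * sqrt (x ^ n))"
    by (intro mult_left_mono) auto
  ultimately have key: "real n * real (Suc n) * x ^ n \<le> S n * S (Suc n)"
    by (simp add: mult_ac)
  have "x ^ n / S n - x ^ Suc n / S (Suc n) = x ^ n / (S n * S (Suc n))"
    using pos[OF n] pos[of "Suc n"] S1 by (simp add: divide_simps) (simp add: algebra_simps)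
  also have "\<dots> \<le> 1 / (real n * real (Suc n))"
    using key n pos[OF n] pos[of "Suc n"] by (simp add: divide_simps mult_ac)
  also have "\<dots> = 1 / real n - 1 / real (Suc n)"
    using n by (simp add: field_simps)
  finally have "(1 / real (Suc n) - x ^ Suc n / S (Suc n)) / (1 - x)
      \<le> (1 / real n - x ^ n / S n) / (1 - x)"
    using x by (intro divide_right_mono) auto
  then show ?thesis unfolding S by (simp add: diff_divide_distrib mult.commute del: power_Suc)
qed

text \<open>Both sides are groupings of the absolutely convergent double series of
  \<open>X d * x ^ (d * k)\<close>: by \<open>d\<close>, and by the product
  \<open>m = d * k\<close>.\<close>

lemma Lambert_series:
  fixes X :: "nat \<Rightarrow> real" and x :: real
  assumes X: "\<And>n. \<bar>X n\<bar> \<le> 1" and x: "0 < x" "x < 1"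
  shows "((\<lambda>n. X n * (x ^ n / (1 - x ^ n))) has_sum (\<Sum>\<^sub>\<infinity>m\<in>{1..}. (\<Sum>d | d dvd m. X d)
      * x ^ m)) {1..}"
    and "(\<lambda>m. (\<Sum>d | d dvd m. X d) * x ^ m) summable_on {1..}"
proof -
  define F where "F = (\<lambda>(d :: nat, k :: nat). X d * x ^ (d * k))"
  have geo: "((\<lambda>k. x ^ (d * k)) has_sum (x ^ d / (1 - x ^ d))) {1..}" if "d \<ge> 1" for d
    using has_sum_geometric_from_1[of "x ^ d"] x that by (simp add: power_mult power_less_one_iff)
  have smG: "(\<lambda>d. x ^ d / (1 - x ^ d)) summable_on {1..}"
  proof (rule summable_on_comparison_test[where f = "\<lambda>d. x ^ d / (1 - x)"])
    show "(\<lambda>d. x ^ d / (1 - x)) summable_on {1..}"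
      using has_sum_divide_const[OF has_sum_geometric_from_1[of x], of "1 - x"] x
      by (intro has_sum_imp_summable) auto
    fix d :: nat assume "d \<in> {1..}"
    then have "x ^ d \<le> x" using x power_decreasing[of 1 d x] by simp
    then show "x ^ d / (1 - x ^ d) \<le> x ^ d / (1 - x)"
      using x by (intro divide_left_mono) auto
    show "0 \<le> x ^ d / (1 - x ^ d)" using x by (simp add: power_le_one)
  qed
  have smP: "(\<lambda>(d, k). x ^ (d * k)) summable_on {1..} \<times> {1..}"
    by (rule summable_on_SigmaI[OF _ smG]) (use geo x in auto)
  have smF: "F summable_on {1..} \<times> {1..}"
  proof -
    have "(\<lambda>z. norm (F z)) summable_on {1..} \<times> {1..}"
      by (rule summable_on_comparison_test[OF smP])
        (use x X in \<open>auto simp: F_def abs_mult intro: mult_left_le_one_le\<close>)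
    then show ?thesis by (rule abs_summable_summable)
  qed
  have bij: "bij_betw (\<lambda>(m, d). (d, m div d)) (SIGMA m:{1::nat..}. {d. d dvd m}) ({1::nat..} \<times>
      {1::nat..})"
  proof (rule bij_betwI[where g = "\<lambda>(d, k). (d * k, d)"])
    show "(\<lambda>(m, d). (d, m div d)) \<in> (SIGMA m:{1::nat..}. {d. d dvd m}) \<rightarrow> {1::nat..} \<times> {1::nat..}"
      by (auto simp: Suc_le_eq elim!: dvdE)
  qed auto
  have sF: "(F has_sum infsum F ({1..} \<times> {1..})) ({1..} \<times> {1..})" using smF by simp
  have "((\<lambda>z. F (case z of (m, d) \<Rightarrow> (d, m div d))) has_sum infsum F ({1..} \<times> {1..})) (SIGMA
      m:{1..}. {d. d dvd m})"
    using has_sum_reindex_bij_betw[OF bij] sF by blast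
  then have "((\<lambda>(m, d). X d * x ^ m) has_sum infsum F ({1..} \<times> {1..})) (SIGMA m:{1..}. {d. d dvd
      m})"
    by (rule has_sum_cong[THEN iffD1, rotated]) (auto simp: F_def)
  then have hs: "((\<lambda>m. (\<Sum>d | d dvd m. X d) * x ^ m) has_sum infsum F ({1..} \<times> {1..})) {1..}"
  proof (rule has_sum_SigmaD)
    fix m :: nat assume "m \<in> {1..}"
    then have "finite {d. d dvd m}" by auto
    then show "((\<lambda>d. case (m, d) of (m, d) \<Rightarrow> X d * x ^ m) has_sum (\<Sum>d | d dvd m. X d)
        * x ^ m) {d. d dvd m}"
      by (simp add: has_sum_finiteI sum_distrib_right)
  qed
  then show "(\<lambda>m. (\<Sum>d | d dvd m. X d) * x ^ m) summable_on {1..}" by (rule has_sum_imp_summable)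
  have "((\<lambda>n. X n * (x ^ n / (1 - x ^ n))) has_sum infsum F ({1..} \<times> {1..})) {1..}"
    using sF
  proof (rule has_sum_SigmaD)
    fix n :: nat assume "n \<in> {1..}"
    then show "((\<lambda>k. F (n, k)) has_sum X n * (x ^ n / (1 - x ^ n))) {1..}"
      using has_sum_cmult_right[OF geo, of n "X n"] by (simp add: F_def)
  qed
  then show "((\<lambda>n. X n * (x ^ n / (1 - x ^ n))) has_sum (\<Sum>\<^sub>\<infinity>m\<in>{1..}. (\<Sum>d | d dvd m. X d)
      * x ^ m)) {1..}"
    using infsumI[OF hs] by simp
qed

lemma real_character_sum_nonzero:
  fixes X :: "nat \<Rightarrow> real"
  assumes mult: "\<And>m n. X (m * n) = X m * X n" and one: "X 1 = 1"
    and vals: "\<And>n. X n \<in> {-1, 0, 1}"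
    and bd: "\<And>n. \<bar>\<Sum>i<n. X i\<bar> \<le> B"
  shows "\<not> (\<lambda>n. X n / real n) sums 0"
proof
  assume L0: "(\<lambda>n. X n / real n) sums 0"
  have X1: "\<bar>X n\<bar> \<le> 1" for n using vals[of n] by auto
  have upper: "(\<Sum>\<^sub>\<infinity>m\<in>{1..}. (\<Sum>d | d dvd m. X d) * x ^ m) \<le> 2 * B" if x: "0 < x" "x < 1" for x
  proof -
    \<comment> \<open>Since the sum of \<open>X n / n\<close> is assumed to be 0, a multiple of it
      can be subtracted from the Lambert series for free. This cancels the blow-up of the
      coefficients as \<open>x\<close> tends to 1.\<close>
    define b where "b n = 1 / (real n * (1 - x)) - x ^ n / (1 - x ^ n)" for n
    have b01: "b 0 = 0" "b 1 = 1" using x by (auto simp: b_def field_simps)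
    have "(\<lambda>n. X n / real n * (1 / (1 - x))) sums (0 * (1 / (1 - x)))" using L0 by (rule sums_mult2)
    moreover have "(\<lambda>n. X n * (x ^ n / (1 - x ^ n))) sums (\<Sum>\<^sub>\<infinity>m\<in>{1..}. (\<Sum>d | d dvd m. X d) * x ^ m)"
    proof (rule has_sum_imp_sums)
      show "((\<lambda>n. X n * (x ^ n / (1 - x ^ n))) has_sum (\<Sum>\<^sub>\<infinity>m\<in>{1..}. (\<Sum>d | d dvd m. X d)
          * x ^ m)) UNIV"
        using Lambert_series(1)[of X x, OF X1 x]
        by (rule has_sum_cong_neutral[THEN iffD1, rotated -1]) (auto simp: not_le)
    qed
    ultimately have "(\<lambda>n. X n / real n * (1 / (1 - x)) - X n * (x ^ n / (1 - x ^ n))) sums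
        (0 * (1 / (1 - x)) - (\<Sum>\<^sub>\<infinity>m\<in>{1..}. (\<Sum>d | d dvd m. X d) * x ^ m))"
      by (rule sums_diff)
    moreover have "(\<lambda>n. X n / real n * (1 / (1 - x)) - X n * (x ^ n / (1 - x ^ n)))
        = (\<lambda>n. X n * b n)"
      by (rule ext) (simp add: b_def algebra_simps)
    ultimately have sb: "(\<lambda>n. X n * b n) sums - (\<Sum>\<^sub>\<infinity>m\<in>{1..}. (\<Sum>d | d dvd m. X d) * x ^ m)" by simp
    have dec: "b (Suc n) \<le> b n" if "n \<ge> 1" for n
      using Lambert_difference_decreasing[OF x that] by (simp only: b_def)
    have lim: "b \<longlonglongrightarrow> 0"
    proof -
      have "(\<lambda>n. x ^ n) \<longlonglongrightarrow> 0" using x by (intro LIMSEQ_realpow_zero) auto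
      then have "(\<lambda>n. x ^ n / (1 - x ^ n)) \<longlonglongrightarrow> 0 / (1 - 0)"
        by (intro tendsto_divide tendsto_diff tendsto_const) auto
      moreover have "(\<lambda>n. inverse (1 - x) * inverse (real n)) \<longlonglongrightarrow> inverse (1 - x) * 0"
        by (intro tendsto_intros lim_inverse_n)
      ultimately have "(\<lambda>n. inverse (1 - x) * inverse (real n) - x ^ n / (1 - x ^ n)) \<longlonglongrightarrow> 0"
        using tendsto_diff by fastforce
      then show ?thesis by (simp add: b_def[abs_def] field_simps)
    qed
    have "(\<lambda>n. b (n + 1) - b (Suc n + 1)) sums (b (0 + 1) - 0)"
      by (rule telescope_sums') (use lim LIMSEQ_Suc in auto)
    moreover have "\<bar>b (n + 1) - b (Suc (n + 1))\<bar> = b (n + 1) - b (Suc n + 1)" for n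
      using dec[of "n + 1"] by simp
    ultimately have "(\<lambda>n. \<bar>b (n + 1) - b (Suc (n + 1))\<bar>) sums b 1" by simp
    then have "(\<lambda>n. \<bar>b n - b (Suc n)\<bar>) sums (b 1 + (\<Sum>n<1. \<bar>b n - b (Suc n)\<bar>))"
      using sums_iff_shift[of "\<lambda>n. \<bar>b n - b (Suc n)\<bar>" 1] by simp
    \<comment> \<open>The total variation is 2 for every \<open>x\<close>: a rise from
      \<open>b 0 = 0\<close> (division by zero) to \<open>b 1 = 1\<close>, then a monotone descent
      to 0.\<close>
    then have sabs: "(\<lambda>n. \<bar>b n - b (Suc n)\<bar>) sums 2" using b01 by simp
    have bdc: "norm (\<Sum>i<n. complex_of_real (X i)) \<le> B" for n
      using bd[of n] by (metis norm_of_real of_real_sum)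
    have "norm (\<Sum>n. complex_of_real (X n) * complex_of_real (b n)) \<le> B * (\<Sum>n. \<bar>b n - b (Suc n)\<bar>)"
      by (rule Abel_bound(2)[OF bdc lim sums_summable[OF sabs]])
    moreover have "(\<Sum>n. complex_of_real (X n) * complex_of_real (b n))
        = complex_of_real (\<Sum>n. X n * b n)"
      using suminf_of_real[OF sums_summable[OF sb], where 'a = complex, symmetric] by simp
    ultimately have "\<bar>\<Sum>n. X n * b n\<bar> \<le> B * 2"
      using sums_unique[OF sabs] by (metis norm_of_real)
    then show ?thesis using sums_unique[OF sb] by linarith
  qed
  have lower: "(\<Sum>k=1..K. x ^ k\<^sup>2) \<le> 2 * B" if x: "0 < x" "x < 1" for x K
  proof -
    have "(\<Sum>k=1..K. x ^ k\<^sup>2) = (\<Sum>m\<in>power2 ` {1..K}. x ^ m)"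
      by (subst sum.reindex) (auto intro!: inj_onI simp: power2_eq_iff_nonneg)
    also have "\<dots> \<le> (\<Sum>m\<in>power2 ` {1..K}. (\<Sum>d | d dvd m. X d) * x ^ m)"
    proof (rule sum_mono)
      fix m assume "m \<in> power2 ` {1..K}"
      then have "(\<Sum>d | d dvd m. X d) \<ge> 1"
        using divisor_sum_nonneg[OF mult one vals, of m] by auto
      then show "x ^ m \<le> (\<Sum>d | d dvd m. X d) * x ^ m" using x by simp
    qed
    also have "\<dots> \<le> (\<Sum>\<^sub>\<infinity>m\<in>{1..}. (\<Sum>d | d dvd m. X d) * x ^ m)"
      by (rule finite_sum_le_infsum[OF Lambert_series(2)[of X x, OF X1 x]])
        (use divisor_sum_nonneg[OF mult one vals] x in auto)
    also have "\<dots> \<le> 2 * B" by (rule upper[OF x])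
    finally show ?thesis .
  qed
  \<comment> \<open>As \<open>x\<close> tends to 1 from below, each of the first \<open>K\<close>
    squares contributes 1, against a bound that does not depend on \<open>K\<close>.\<close>
  have "real K \<le> 2 * B" for K
  proof -
    have "((\<lambda>x. \<Sum>k=1..K. x ^ k\<^sup>2) \<longlongrightarrow> (\<Sum>k=1..K. (1::real) ^ k\<^sup>2)) (at_left 1)"
      by (intro tendsto_intros)
    moreover have "eventually (\<lambda>x. x \<in> {0<..<1::real}) (at_left 1)"
      by (rule eventually_at_left_real) simp
    then have "eventually (\<lambda>x. (\<Sum>k=1..K. x ^ k\<^sup>2) \<le> 2 * B) (at_left 1)"
      by eventually_elim (use lower in auto)
    ultimately have "(\<Sum>k=1..K. (1::real) ^ k\<^sup>2) \<le> 2 * B"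
      by (rule tendsto_upperbound) simp
    then show ?thesis by simp
  qed
  then show False using reals_Archimedean2[of "2 * B"] by (metis not_le)
qed

section \<open>L-functions to the right of 1\<close>

context prime_character_generator
begin

text \<open>The Dirichlet characters modulo \<open>q\<close> are the powers \<open>w ^ j\<close> with \<open>1 \<le> j \<le> q - 1\<close>;
  the exponent \<open>q - 1\<close>, rather than 0, gives the principal one, as it vanishes at multiples of \<open>q\<close>.\<close>

definition term_at :: "nat \<Rightarrow> real \<Rightarrow> nat \<Rightarrow> complex" where
  "term_at j s n = w n ^ j * of_real (real n powr - s)"

definition Lfun :: "nat \<Rightarrow> real \<Rightarrow> complex" where
  "Lfun j s = infsum (term_at j s) UNIV"

lemma term_at_mult: "term_at j s (m * n) = term_at j s m * term_at j s n"
  by (simp add: term_at_def w_mult power_mult_distrib powr_mult)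

lemma term_at_1: "term_at j s 1 = 1"
  using w_1 by (simp add: term_at_def)

lemma term_at_0: "term_at j s 0 = 0"
  by (simp add: term_at_def)

lemma norm_term_at_le: "norm (term_at j s n) \<le> real n powr - s"
  using norm_w_le[of n] by (simp add: term_at_def norm_mult norm_power mult_left_le_one_le
      power_le_one)

lemma norm_term_at_summable:
  assumes "s > 1"
  shows "(\<lambda>n. norm (term_at j s n)) summable_on A"
  by (rule summable_on_comparison_test[OF powr_summable_on[OF assms]]) (use norm_term_at_le in auto)

lemma term_at_summable: "s > 1 \<Longrightarrow> term_at j s summable_on A"
  using norm_term_at_summable abs_summable_summable by blast

lemma norm_Lfun_le:
  assumes s: "s > 1"
  shows "norm (Lfun j s) \<le> 1 + 1 / (s - 1)"
proof -
  have "norm (Lfun j s) \<le> (\<Sum>\<^sub>\<infinity>n. norm (term_at j s n))"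
    unfolding Lfun_def by (intro norm_infsum_bound norm_term_at_summable s)
  also have "\<dots> \<le> (\<Sum>\<^sub>\<infinity>n. real n powr - s)"
    by (intro infsum_mono norm_term_at_summable powr_summable_on norm_term_at_le s)
  also have "\<dots> \<le> 1 + 1 / (s - 1)" by (rule infsum_powr_bounds(1)[OF s])
  finally show ?thesis .
qed

text \<open>The L-series with the Euler factors of all primes up to \<open>y\<close> removed;
  \<open>sieved_eq\<close> makes this precise.\<close>

definition sieved :: "nat \<Rightarrow> real \<Rightarrow> nat \<Rightarrow> complex" where
  "sieved j s y = infsum (term_at j s) {n. \<forall>p\<in>{p. prime p \<and> p \<le> y}. \<not> p dvd n}"

text \<open>The local factors are not inverted, so this is the absolute value of the reciprocal of
  the truncated Euler product of all characters together.\<close>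

definition Euler_product :: "real \<Rightarrow> nat \<Rightarrow> real" where
  "Euler_product s y = (\<Prod>p | prime p \<and> p \<le> y. norm (\<Prod>j\<in>{1..q-1}. 1 - term_at j s p))"

lemma sieved_eq:
  assumes "s > 1"
  shows "sieved j s y = (\<Prod>p | prime p \<and> p \<le> y. 1 - term_at j s p) * Lfun j s"
  unfolding sieved_def Lfun_def
  by (rule infsum_coprime_eq_prod[OF term_at_mult term_at_summable[OF assms]]) auto

lemma norm_sieved_minus_1_le:
  assumes s: "s > 1" and y: "y \<ge> 1"
  shows "norm (sieved j s y - 1) \<le> real y powr (1 - s) / (s - 1)"
proof -
  have "norm (sieved j s y - 1) \<le> (\<Sum>\<^sub>\<infinity>n\<in>{y<..}. norm (term_at j s n))"
    unfolding sieved_def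
    by (rule norm_infsum_coprime_minus_1_le[OF term_at_1 term_at_0 norm_term_at_summable[OF s] y])
  also have "\<dots> \<le> (\<Sum>\<^sub>\<infinity>n\<in>{y<..}. real n powr - s)"
    by (intro infsum_mono norm_term_at_summable powr_summable_on norm_term_at_le s)
  also have "\<dots> \<le> real y powr (1 - s) / (s - 1)" by (rule infsum_powr_tail_le[OF s y])
  finally show ?thesis .
qed

lemma Euler_product_mult_Lfun:
  assumes s: "s > 1"
  shows "Euler_product s y * (\<Prod>j\<in>{1..q-1}. norm (Lfun j s)) = (\<Prod>j\<in>{1..q-1}. norm (sieved j s y))"
proof -
  have "Euler_product s y = (\<Prod>j\<in>{1..q-1}. norm (\<Prod>p | prime p \<and> p \<le> y. 1 - term_at j s p))"
    unfolding Euler_product_def prod_norm[symmetric] by (rule prod.swap)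
  then show ?thesis by (simp add: sieved_eq[OF s] norm_mult prod.distrib)
qed

text \<open>Every \<open>w q ^ j\<close> vanishes, because the exponents \<open>j\<close> start at
  1.\<close>

lemma local_factor_dvd:
  "norm (\<Prod>j\<in>{1..q-1}. 1 - term_at j s q) = 1"
proof -
  have "(\<Prod>j\<in>{1..q-1}. 1 - term_at j s q) = 1"
    by (rule prod.neutral) (use w_eq_0_iff[of q] in \<open>auto simp: term_at_def zero_power\<close>)
  then show ?thesis by simp
qed

lemma local_factor_eq:
  "(\<Prod>j\<in>{1..q-1}. 1 - term_at j s p) = (\<Prod>j\<in>{1..q-1}. 1 - w p ^ j
      * complex_of_real (real p powr - s))"
  by (simp add: term_at_def)

lemma prime_powr_bounds:
  assumes p: "prime p" and s: "s > 1"
  shows "0 \<le> real p powr - s" "real p powr - s \<le> 1 / real p" "real p powr - s \<le> 1 / 2"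
proof -
  have "p \<ge> 2" using p prime_ge_2_nat by blast
  have "real p powr - s \<le> real p powr -1" using s \<open>p \<ge> 2\<close> by (intro powr_mono) auto
  also have "\<dots> = 1 / real p" using \<open>p \<ge> 2\<close> by (simp add: powr_minus divide_inverse)
  finally show *: "real p powr - s \<le> 1 / real p" .
  have "1 / real p \<le> 1 / 2" using \<open>p \<ge> 2\<close> by (intro divide_left_mono) auto
  then show "real p powr - s \<le> 1 / 2" using * by linarith
qed simp

lemma local_factor_le_1:
  assumes p: "prime p" and s: "s > 1"
  shows "norm (\<Prod>j\<in>{1..q-1}. 1 - term_at j s p) \<le> 1"
proof (cases "p = q")
  case True
  then show ?thesis using local_factor_dvd by simp
next
  case False
  then have "\<not> q dvd p" using p prime_q primes_dvd_imp_eq by blast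
  then show ?thesis unfolding local_factor_eq
    by (intro root_of_unity_product_le_1 w_root) (use q_gt_1 prime_powr_bounds[OF p s] in auto)
qed

lemma Euler_product_le_1: "s > 1 \<Longrightarrow> Euler_product s y \<le> 1"
  unfolding Euler_product_def by (intro prod_le_1) (use local_factor_le_1 in auto)

text \<open>The sieved series tend to 1 as \<open>y\<close> grows, and they arise from the
  L-functions by multiplying with a truncated product that is at most 1.\<close>

lemma prod_norm_Lfun_ge_1:
  assumes s: "s > 1"
  shows "(\<Prod>j\<in>{1..q-1}. norm (Lfun j s)) \<ge> 1"
proof -
  have "(\<lambda>y. sieved j s y) \<longlonglongrightarrow> 1" for j
  proof -
    have "(\<lambda>y. sieved j s y - 1) \<longlonglongrightarrow> 0"
    proof (rule Lim_null_comparison)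
      show "\<forall>\<^sub>F y in sequentially. norm (sieved j s y - 1) \<le> real y powr (1 - s) / (s - 1)"
        using eventually_ge_at_top[of 1] by eventually_elim (rule norm_sieved_minus_1_le[OF s])
      have "(\<lambda>y. real y powr (1 - s)) \<longlonglongrightarrow> 0"
        using s by (intro tendsto_neg_powr filterlim_real_sequentially) auto
      then show "(\<lambda>y. real y powr (1 - s) / (s - 1)) \<longlonglongrightarrow> 0"
        by (simp add: tendsto_divide_zero)
    qed
    then show ?thesis by (simp add: LIM_zero_iff)
  qed
  then have lim: "(\<lambda>y. \<Prod>j\<in>{1..q-1}. norm (sieved j s y)) \<longlonglongrightarrow> (\<Prod>j\<in>{1..q-1}. norm (1 :: complex))"
    by (intro tendsto_prod tendsto_norm)
  have "(\<Prod>j\<in>{1..q-1}. norm (sieved j s y)) \<le> (\<Prod>j\<in>{1..q-1}. norm (Lfun j s))" for y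
    unfolding Euler_product_mult_Lfun[OF s, symmetric]
    by (rule mult_left_le_one_le)
      (use Euler_product_le_1[OF s] in \<open>auto simp: Euler_product_def intro!: prod_nonneg\<close>)
  then have "(\<Prod>j\<in>{1..q-1}. norm (1 :: complex)) \<le> (\<Prod>j\<in>{1..q-1}. norm (Lfun j s))"
    by (intro LIMSEQ_le_const2[OF lim] exI allI impI)
  then show ?thesis by simp
qed

text \<open>Away from the multiples of \<open>q\<close> the values of \<open>w\<close> lie on the
  unit circle, so the inverse character is the conjugate one. A zero at 1 of a non-real character
  thus comes with a second zero.\<close>

lemma Lfun_conjugate:
  assumes j: "0 < j" "j < q - 1"
  shows "Lfun (q - 1 - j) s = cnj (Lfun j s)"
proof -
  have "w n ^ (q - 1 - j) = cnj (w n ^ j)" for n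
  proof (cases "q dvd n")
    case True
    then show ?thesis using w_eq_0_iff[of n] j by (simp add: zero_power)
  next
    case False
    have "w n ^ (q - 1 - j) * w n ^ j = 1"
      using w_root[OF False] j by (simp flip: power_add)
    moreover have "norm (w n) = 1"
      using w_root[OF False] q_gt_1
      by (metis norm_ge_zero norm_one norm_power power_eq_1_iff zero_less_diff not_gr_zero
          less_irrefl)
    then have "cnj (w n ^ j) * w n ^ j = 1"
      using complex_norm_square[of "w n ^ j"] by (simp add: norm_power mult.commute)
    moreover have "w n ^ j \<noteq> 0" using w_eq_0_iff False by simp
    ultimately show ?thesis by (metis mult_right_cancel)
  qed
  then show ?thesis unfolding Lfun_def infsum_cnj[symmetric] by (simp add: term_at_def[abs_def])
qed

text \<open>The principal L-function is zeta without its factor at \<open>q\<close>, and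
  \<open>1 - q powr - s\<close> is at least 1/2.\<close>

lemma Lfun_principal_ge:
  assumes s: "s > 1"
  shows "norm (Lfun (q - 1) s) \<ge> 1 / (2 * (s - 1))"
proof -
  have nz: "w n ^ (q - 1) = (if q dvd n then 0 else 1)" for n
    using w_root[of n] w_eq_0_iff[of n] q_gt_1 by (simp add: zero_power)
  define f where "f n = complex_of_real (real n powr - s)" for n
  have sm: "f summable_on A" for A
    unfolding f_def using powr_summable_on[OF s] by (rule summable_on_of_real)
  have "Lfun (q - 1) s = infsum f {n. \<forall>p\<in>{q}. \<not> p dvd n}"
    unfolding Lfun_def by (rule infsum_cong_neutral) (auto simp: term_at_def nz f_def simp del:
        One_nat_def)
  also have "\<dots> = (1 - f q) * infsum f UNIV"
    by (subst infsum_coprime_eq_prod[OF _ sm]) (use prime_q in \<open>auto simp: f_def powr_mult\<close>)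
  also have "infsum f UNIV = complex_of_real (\<Sum>\<^sub>\<infinity>n. real n powr - s)"
    unfolding f_def using powr_summable_on[OF s] by (intro infsumI has_sum_of_real) simp
  also have "(1 - f q) * complex_of_real (\<Sum>\<^sub>\<infinity>n. real n powr - s)
      = complex_of_real ((1 - real q powr - s) * (\<Sum>\<^sub>\<infinity>n. real n powr - s))"
    by (simp add: f_def)
  finally have "norm (Lfun (q - 1) s) = \<bar>(1 - real q powr - s) * (\<Sum>\<^sub>\<infinity>n. real n powr - s)\<bar>"
    by (metis norm_of_real)
  moreover have "(1 - real q powr - s) * (\<Sum>\<^sub>\<infinity>n. real n powr - s) \<ge> (1 / 2) * (1 / (s - 1))"
    using prime_powr_bounds[OF prime_q s] infsum_powr_bounds(2)[OF s] s by (intro mult_mono) auto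
  ultimately show ?thesis by simp
qed

end

section \<open>Nonvanishing at 1 and primes congruent to 1\<close>

text \<open>The derivative of \<open>1 / x - x powr - s\<close> is at most
  \<open>(s - 1) * (1 + ln x) / x\<^sup>2\<close> in absolute value. Bounding the logarithm by a
  square root leaves the summable power -3/2 and keeps the factor \<open>s - 1\<close>.\<close>

lemma powr_difference_variation:
  fixes s :: real
  assumes s: "s > 1" and n: "n \<ge> 1"
  shows "\<bar>(real n powr -1 - real n powr - s) - (real (Suc n) powr -1 - real (Suc n) powr - s)\<bar>
           \<le> 2 * (s - 1) * real n powr (-3/2)"
proof -
  have "\<exists>z. real n < z \<and> z < real (Suc n) \<and>
      (real (Suc n) powr -1 - real (Suc n) powr - s) - (real n powr -1 - real n powr - s) =
        (real (Suc n) - real n) * (- (z powr -2) + s * z powr (- s - 1))"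
  proof (rule MVT2)
    fix x assume "real n \<le> x" "x \<le> real (Suc n)"
    then have "x > 0" using n by simp
    then show "((\<lambda>x. x powr -1 - x powr - s) has_real_derivative (- (x powr -2) + s
        * x powr (- s - 1))) (at x)"
      using DERIV_diff[OF has_real_derivative_powr[OF \<open>x > 0\<close>, of "-1"]
          has_real_derivative_powr[OF \<open>x > 0\<close>, of "-s"]]
      by (simp add: algebra_simps)
  qed simp
  then obtain z where z: "real n < z" "z < real (Suc n)"
    and eq: "(real (Suc n) powr -1 - real (Suc n) powr - s) - (real n powr -1 - real n powr - s) =
        - (z powr -2) + s * z powr (- s - 1)"
    by auto
  have z1: "z > 1" using z n by linarith
  have "- s - 1 = -2 + (1 - s)" by simp
  then have "z powr (- s - 1) = z powr -2 * z powr (1 - s)"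
    by (simp only: powr_add)
  then have "- (z powr -2) + s * z powr (- s - 1)
      = z powr -2 * ((s - 1) * z powr (1 - s) - (1 - z powr (1 - s)))"
    by (simp add: algebra_simps)
  moreover have "\<bar>(s - 1) * z powr (1 - s) - (1 - z powr (1 - s))\<bar> \<le> (s - 1) * (1 + ln z)"
  proof -
    have "z powr (1 - s) \<le> 1" using z1 s powr_mono[of "1 - s" 0 z] by simp
    then have "(s - 1) * z powr (1 - s) \<le> s - 1" using s by (simp add: mult_left_le)
    moreover have "1 - z powr (1 - s) \<le> (s - 1) * ln z"
      using exp_ge_add_one_self[of "(1 - s) * ln z"] z1 by (simp add: powr_def algebra_simps)
    moreover have "0 \<le> (s - 1) * z powr (1 - s)" using s by simp
    moreover have "0 \<le> (s - 1) * ln z" using s z1 by simp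
    ultimately show ?thesis using \<open>z powr (1 - s) \<le> 1\<close> by (simp add: distrib_left abs_le_iff)
  qed
  moreover have "1 + ln z \<le> 2 * z powr (1/2)"
  proof -
    have "ln (z powr (1/2)) \<le> z powr (1/2) - 1" using z1 by (intro ln_le_minus_one) auto
    then show ?thesis using z1 by (simp add: ln_powr)
  qed
  then have "(s - 1) * (1 + ln z) \<le> (s - 1) * (2 * z powr (1/2))"
      using s by (intro mult_left_mono) auto
  ultimately have "\<bar>- (z powr -2) + s * z powr (- s - 1)\<bar>
      \<le> z powr -2 * ((s - 1) * (2 * z powr (1/2)))"
    by (simp add: abs_mult mult_left_mono)
  also have "\<dots> = 2 * (s - 1) * (z powr -2 * z powr (1/2))" by simp
  also have "z powr -2 * z powr (1/2) = z powr (-3/2)"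
    by (subst powr_add[symmetric]) simp
  also have "2 * (s - 1) * z powr (-3/2) \<le> 2 * (s - 1) * real n powr (-3/2)"
    using s z n by (intro mult_left_mono powr_mono2') auto
  finally show ?thesis using eq by linarith
qed

lemma prime_inverse_le_1: "prime p \<Longrightarrow> 1 / real p \<le> 1"
  using prime_ge_1_nat[of p] by simp

context prime_character_generator
begin

text \<open>Summation by parts against \<open>n powr -1 - n powr - s\<close>, whose total variation
  is \<open>O(s - 1)\<close>. At 1 itself the series converges only conditionally, so its value is
  stated with \<open>sums\<close>.\<close>

lemma Lfun_Lipschitz_at_1:
  assumes j: "0 < j" "j < q - 1"
  shows "\<exists>L K. (\<lambda>n. w n ^ j / of_nat n) sums L \<and> (\<forall>s>1. norm (Lfun j s - L) \<le> K * (s - 1))"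
proof -
  note bd = norm_sum_w_power_le[OF j]
  have lim: "(\<lambda>n. real n powr - s) \<longlonglongrightarrow> 0" if "s \<ge> 1" for s
    using that by (intro tendsto_neg_powr filterlim_real_sequentially) auto
  have smh: "summable (\<lambda>n. \<bar>real n powr -1 - real (Suc n) powr -1\<bar>)"
  proof -
    have "summable (\<lambda>n. real (n + 1) powr -1 - real (Suc n + 1) powr -1)"
      using telescope_summable'[OF LIMSEQ_Suc[OF lim[of 1]]] by simp
    moreover have "real (n + 1) powr -1 - real (Suc n + 1) powr -1
        = \<bar>real (n + 1) powr -1 - real (Suc (n + 1)) powr -1\<bar>" for n
      using powr_mono2'[of "-1" "real (n + 1)" "real (Suc (n + 1))"] by simp
    ultimately have "summable (\<lambda>n. \<bar>real (n + 1) powr -1 - real (Suc (n + 1)) powr -1\<bar>)" by simp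
    then show ?thesis using summable_iff_shift[of "\<lambda>n. \<bar>real n powr -1 - real (Suc n) powr -1\<bar>" 1]
        by blast
  qed
  define L where "L = (\<Sum>n. w n ^ j * complex_of_real (real n powr -1))"
  have smL: "summable (\<lambda>n. w n ^ j * complex_of_real (real n powr -1))"
    by (rule Abel_bound(1)[OF bd lim smh]) simp
  have "(\<lambda>n. w n ^ j * complex_of_real (real n powr -1)) sums L"
    unfolding L_def using smL by (rule summable_sums)
  moreover have "w n ^ j * complex_of_real (real n powr -1) = w n ^ j / of_nat n" for n
    by (cases "n = 0") (auto simp: powr_minus divide_inverse)
  ultimately have sL: "(\<lambda>n. w n ^ j / of_nat n) sums L" by simp
  define Z where "Z = (\<Sum>n. real n powr (-3/2))"
  have smZ: "summable (\<lambda>n. real n powr (-3/2))"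
    using powr_summable_on[of "3/2" UNIV] by (intro summable_on_imp_summable) simp
  have "norm (Lfun j s - L) \<le> (2 * real q * Z) * (s - 1)" if s: "s > 1" for s
  proof -
    define D where "D n = real n powr -1 - real n powr - s" for n :: nat
    have D: "\<bar>D n - D (Suc n)\<bar> \<le> 2 * (s - 1) * real n powr (-3/2)" for n
    proof (cases "n = 0")
      case False
      then show ?thesis using powr_difference_variation[OF s, of n] by (simp add: D_def)
    qed (simp add: D_def)
    have smD: "summable (\<lambda>n. \<bar>D n - D (Suc n)\<bar>)"
      by (rule summable_comparison_test[OF _ summable_mult[OF smZ, of "2
          * (s - 1)"]]) (use D in auto)
    have limD: "D \<longlonglongrightarrow> 0"
      unfolding D_def[abs_def] using tendsto_diff[OF lim[of 1] lim[of s]] s by simp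
    have "(\<lambda>n. term_at j s n) sums Lfun j s"
      unfolding Lfun_def using term_at_summable[OF s, of j UNIV] by (intro has_sum_imp_sums) simp
    then have "(\<lambda>n. w n ^ j * complex_of_real (real n powr -1) - term_at j s n) sums (L - Lfun j s)"
      using summable_sums[OF smL] unfolding L_def by (intro sums_diff)
    moreover have "w n ^ j * complex_of_real (real n powr -1) - term_at j s n
        = w n ^ j * complex_of_real (D n)" for n
      by (simp add: term_at_def D_def algebra_simps)
    ultimately have "(\<lambda>n. w n ^ j * complex_of_real (D n)) sums (L - Lfun j s)" by simp
    then have "norm (L - Lfun j s) \<le> real q * (\<Sum>n. \<bar>D n - D (Suc n)\<bar>)"
      using Abel_bound(2)[OF bd limD smD] by (simp add: sums_iff)
    also have "\<dots> \<le> real q * (\<Sum>n. 2 * (s - 1) * real n powr (-3/2))"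
      by (intro mult_left_mono suminf_le D smD summable_mult smZ) auto
    also have "(\<Sum>n. 2 * (s - 1) * real n powr (-3/2)) = 2 * (s - 1) * Z"
      unfolding Z_def by (rule suminf_mult[OF smZ])
    finally show ?thesis by (simp add: norm_minus_commute algebra_simps)
  qed
  then show ?thesis using sL by blast
qed

lemma Lfun_tendsto_at_1:
  assumes j: "0 < j" "j < q - 1" and L: "(\<lambda>n. w n ^ j / of_nat n) sums L"
  shows "(Lfun j \<longlongrightarrow> L) (at_right 1)"
proof -
  obtain L' K where *: "(\<lambda>n. w n ^ j / of_nat n) sums L'" "\<forall>s>1. norm (Lfun j s - L') \<le> K * (s - 1)"
    using Lfun_Lipschitz_at_1[OF j] by blast
  then have "L' = L" using L sums_unique2 by blast
  have "((\<lambda>s. Lfun j s - L) \<longlongrightarrow> 0) (at_right 1)"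
  proof (rule Lim_null_comparison)
    show "\<forall>\<^sub>F s in at_right 1. norm (Lfun j s - L) \<le> K * (s - 1)"
      using eventually_at_right_less by eventually_elim (use * \<open>L' = L\<close> in auto)
    have "((\<lambda>s. K * (s - 1)) \<longlongrightarrow> K * (1 - 1)) (at_right (1::real))"
      by (intro tendsto_intros)
    then show "((\<lambda>s. K * (s - 1)) \<longlongrightarrow> 0) (at_right (1::real))" by simp
  qed
  then show ?thesis by (simp add: LIM_zero_iff)
qed

text \<open>If \<open>2 * j = q - 1\<close>, the character is real and Monsky's argument applies.
  Otherwise the conjugate L-function vanishes at 1 as well, and two zeros outweigh the simple pole
  of the principal one, contradicting \<open>prod_norm_Lfun_ge_1\<close>.\<close>

lemma Lfun_1_nonzero:
  assumes j: "0 < j" "j < q - 1" and L: "(\<lambda>n. w n ^ j / of_nat n) sums L"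
  shows "L \<noteq> 0"
proof
  assume "L = 0"
  show False
  proof (cases "2 * j = q - 1")
    case True
    have sq: "(w n ^ j)\<^sup>2 \<in> {0, 1}" for n
      using w_root[of n] w_eq_0_iff[of n] q_gt_1 j True
      by (cases "q dvd n") (auto simp: zero_power mult.commute simp flip: power_mult)
    have vals: "w n ^ j \<in> {-1, 0, 1}" for n
      using sq[of n] by (auto simp: power2_eq_1_iff)
    define X where "X n = Re (w n ^ j)" for n
    have wX: "w n ^ j = complex_of_real (X n)" for n
      using vals[of n] by (auto simp: X_def)
    have bd: "\<bar>\<Sum>i<n. X i\<bar> \<le> real q" for n
      using norm_sum_w_power_le[OF j, of n] unfolding wX by (metis norm_of_real of_real_sum)
    have "(\<lambda>n. X n / real n) sums Re L"
      using sums_Re[OF L] unfolding wX by simp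
    moreover have "\<not> (\<lambda>n. X n / real n) sums 0"
    proof (rule real_character_sum_nonzero[OF _ _ _ bd])
      show "X (m * n) = X m * X n" for m n
      proof -
        have "complex_of_real (X (m * n)) = complex_of_real (X m * X n)"
          unfolding of_real_mult wX[symmetric] by (simp add: w_mult power_mult_distrib)
        then show ?thesis by (simp only: of_real_eq_iff)
      qed
      show "X 1 = 1" using w_1 by (simp add: X_def)
      show "X n \<in> {-1, 0, 1}" for n using vals[of n] by (auto simp: X_def)
    qed
    ultimately show False using \<open>L = 0\<close> by simp
  next
    case False
    define j' where "j' = q - 1 - j"
    have j': "0 < j'" "j' < q - 1" "j' \<noteq> j" using j False by (auto simp: j'_def)
    obtain L' K where *: "(\<lambda>n. w n ^ j / of_nat n) sums L'" "\<forall>s>1. norm (Lfun j s - L')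
        \<le> K * (s - 1)"
      using Lfun_Lipschitz_at_1[OF j] by blast
    have L': "L' = 0" using * L sums_unique2 \<open>L = 0\<close> by blast
    define R where "R = {1..<q-1} - {j, j'}"
    have set_eq: "{1..q-1} = insert (q-1) (insert j (insert j' R))"
      using j j' by (auto simp: R_def)
    have fin: "finite R" by (simp add: R_def)
    have "\<forall>i\<in>R. \<exists>L. (Lfun i \<longlongrightarrow> L) (at_right 1)"
      using Lfun_tendsto_at_1 Lfun_Lipschitz_at_1 unfolding R_def
          by (metis DiffD1 atLeastLessThan_iff less_eq_Suc_le One_nat_def)
    then obtain l where l: "\<And>i. i \<in> R \<Longrightarrow> (Lfun i \<longlongrightarrow> l i) (at_right 1)" by metis
    \<comment> \<open>Two factors are at most \<open>K * (s - 1)\<close>, and for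
      \<open>s < 2\<close> the principal one is at most \<open>2 / (s - 1)\<close>, so one factor
      \<open>s - 1\<close> survives. The characters in \<open>R\<close> have finite limits at
      1.\<close>
    have ge1: "1 \<le> 2 * K\<^sup>2 * (s - 1) * (\<Prod>i\<in>R. norm (Lfun i s))" if s: "1 < s" "s < 2" for s
    proof -
      have a: "norm (Lfun j s) \<le> K * (s - 1)" using * L' s by auto
      have b: "norm (Lfun j' s) \<le> K * (s - 1)"
        unfolding j'_def Lfun_conjugate[OF j] using a by simp
      have c: "norm (Lfun (q - 1) s) \<le> 2 / (s - 1)"
        using norm_Lfun_le[OF s(1), of "q - 1"] s by (simp add: field_simps)
      have P: "0 \<le> (\<Prod>i\<in>R. norm (Lfun i s))" by (simp add: prod_nonneg)
      have "0 \<le> K * (s - 1)" using a norm_ge_zero order_trans by blast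
      then have K: "0 \<le> K" using s by (simp add: zero_le_mult_iff)
      have "1 \<le> (\<Prod>i\<in>{1..q-1}. norm (Lfun i s))" by (rule prod_norm_Lfun_ge_1[OF s(1)])
      also have "\<dots> = norm (Lfun (q - 1) s) * (norm (Lfun j s) * (norm (Lfun j' s)
          * (\<Prod>i\<in>R. norm (Lfun i s))))"
        unfolding set_eq using fin j j' by (simp add: R_def)
      also have "\<dots> \<le> 2 / (s - 1) * (K * (s - 1) * (K * (s - 1) * (\<Prod>i\<in>R. norm (Lfun i s))))"
        using a b c P K s by (intro mult_mono mult_nonneg_nonneg) auto
      also have "\<dots> = 2 * K\<^sup>2 * (s - 1) * (\<Prod>i\<in>R. norm (Lfun i s))"
        using s by (simp add: field_simps power2_eq_square)
      finally show ?thesis .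
    qed
    have "((\<lambda>s. 2 * K\<^sup>2 * (s - 1) * (\<Prod>i\<in>R. norm (Lfun i s))) \<longlongrightarrow>
        2 * K\<^sup>2 * (1 - 1) * (\<Prod>i\<in>R. norm (l i))) (at_right 1)"
      by (intro tendsto_intros l)
    moreover have "\<forall>\<^sub>F s in at_right 1. 1 \<le> 2 * K\<^sup>2 * (s - 1) * (\<Prod>i\<in>R. norm (Lfun i s))"
      using eventually_at_right_real[of 1 2] by (auto elim!: eventually_mono intro: ge1)
    ultimately have "1 \<le> 2 * K\<^sup>2 * (1 - 1) * (\<Prod>i\<in>R. norm (l i))"
      by (rule tendsto_lowerbound) simp
    then show False by simp
  qed
qed

section \<open>Truncated Euler products near 1\<close>

text \<open>Near 1 the product of all L-functions is at least a constant times
  \<open>1 / (s - 1)\<close>, by the principal pole and the nonvanishing of the others. The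
  condition on \<open>y\<close> keeps every sieved series within distance 1 of 1.\<close>

lemma Euler_product_upper:
  "\<exists>C>0. \<forall>\<^sub>F s in at_right 1. \<forall>y\<ge>1. real y powr (1 - s) / (s - 1) \<le> 1 \<longrightarrow> Euler_product s y
      \<le> C * (s - 1)"
proof -
  have "\<forall>i\<in>{1..<q-1}. \<exists>L. (Lfun i \<longlongrightarrow> L) (at_right 1) \<and> L \<noteq> 0"
    using Lfun_tendsto_at_1 Lfun_Lipschitz_at_1 Lfun_1_nonzero
        by (metis atLeastLessThan_iff less_eq_Suc_le One_nat_def)
  then obtain l where l: "\<And>i. i \<in> {1..<q-1} \<Longrightarrow> (Lfun i \<longlongrightarrow> l i) (at_right 1) \<and> l i \<noteq> 0" by metis
  define c where "c = (\<Prod>i\<in>{1..<q-1}. norm (l i)) / 2"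
  have c: "c > 0" unfolding c_def using l by (auto intro!: prod_pos)
  have "((\<lambda>s. \<Prod>i\<in>{1..<q-1}. norm (Lfun i s)) \<longlongrightarrow> (\<Prod>i\<in>{1..<q-1}. norm (l i))) (at_right 1)"
    by (intro tendsto_intros) (use l in auto)
  moreover have "c < (\<Prod>i\<in>{1..<q-1}. norm (l i))" using c by (simp add: c_def)
  ultimately have ev: "\<forall>\<^sub>F s in at_right 1. c < (\<Prod>i\<in>{1..<q-1}. norm (Lfun i s))"
    by (rule order_tendstoD)
  have "\<forall>\<^sub>F s in at_right 1. \<forall>y\<ge>1. real y powr (1 - s) / (s - 1) \<le> 1 \<longrightarrow>
      Euler_product s y \<le> (2 ^ (q - 1) * 2 / c) * (s - 1)"
    using ev eventually_at_right_less[of "1::real"]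
  proof eventually_elim
    case (elim s)
    show ?case
    proof (intro allI impI)
      fix y :: nat assume y: "y \<ge> 1" "real y powr (1 - s) / (s - 1) \<le> 1"
      have EP: "Euler_product s y \<ge> 0" by (simp add: Euler_product_def prod_nonneg)
      have "{1..q-1} = insert (q-1) {1..<q-1}" using q_gt_1 by auto
      then have "(\<Prod>j\<in>{1..q-1}. norm (Lfun j s))
          = norm (Lfun (q - 1) s) * (\<Prod>j\<in>{1..<q-1}. norm (Lfun j s))"
        by simp
      also have "\<dots> \<ge> 1 / (2 * (s - 1)) * c"
        using Lfun_principal_ge[of s] elim c by (intro mult_mono) auto
      finally have "Euler_product s y * (1 / (2 * (s - 1)) * c)
          \<le> Euler_product s y * (\<Prod>j\<in>{1..q-1}. norm (Lfun j s))"
        using EP by (intro mult_left_mono) auto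
      also have "\<dots> = (\<Prod>j\<in>{1..q-1}. norm (sieved j s y))"
        using Euler_product_mult_Lfun elim by simp
      also have "\<dots> \<le> (\<Prod>j\<in>{1..q-1}. 2)"
      proof (rule prod_mono, intro conjI)
        fix j
        have "norm (sieved j s y) \<le> norm (1 :: complex) + norm (sieved j s y - 1)" by norm
        then show "norm (sieved j s y) \<le> 2" 
          using order_trans[OF norm_sieved_minus_1_le[OF elim(2) y(1), of j] y(2)] by simp
      qed simp
      finally have "Euler_product s y * (1 / (2 * (s - 1)) * c) \<le> 2 ^ (q - 1)" by simp
      then show "Euler_product s y \<le> (2 ^ (q - 1) * 2 / c) * (s - 1)"
        using elim c by (simp add: field_simps)
    qed
  qed
  then show ?thesis using c by (intro exI[of _ "2 ^ (q - 1) * 2 / c"]) auto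
qed

text \<open>At \<open>p\<close> congruent to 1 all \<open>q - 1\<close> characters take the value 1,
  so the local factor is a full power of \<open>1 - p powr - s\<close>. Every other prime costs at
  most \<open>exp (- (q - 1) / p\<^sup>2)\<close>, a total loss bounded independently of
  \<open>s\<close> and \<open>y\<close>.\<close>

lemma Euler_product_lower:
  assumes s: "s > 1"
  shows "(\<Prod>p | prime p \<and> p \<le> y \<and> [p = 1] (mod q). 1 - 1 / real p) ^ (q - 1) *
           exp (- (real (q - 1) * (\<Sum>\<^sub>\<infinity>n. real n powr -2))) \<le> Euler_product s y"
proof -
  define a where "a p = (if [p = 1] (mod q) then (1 - 1 / real p) ^ (q - 1) else 1)" for p :: nat
  have a_nonneg: "0 \<le> a p" if "prime p" for p
    using prime_inverse_le_1[OF that] by (auto simp: a_def intro!: zero_le_power)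
  have fin: "finite {p. prime p \<and> p \<le> y}" by simp
  have "(\<Prod>p | prime p \<and> p \<le> y \<and> [p = 1] (mod q). 1 - 1 / real p) ^ (q - 1) = (\<Prod>p | prime p \<and> p
      \<le> y. a p)"
  proof -
    have "{p. prime p \<and> p \<le> y \<and> [p = 1] (mod q)} = {p \<in> {p. prime p \<and> p \<le> y}. [p = 1] (mod q)}"
        by auto
    then show ?thesis unfolding a_def prod_power_distrib by (simp only: prod.inter_filter[OF fin])
  qed
  moreover have "exp (- (real (q - 1) * (\<Sum>\<^sub>\<infinity>n. real n powr -2))) \<le> (\<Prod>p | prime p \<and> p
      \<le> y. exp (- (real (q - 1) * real p powr -2)))"
  proof -
    have "(\<Sum>p | prime p \<and> p \<le> y. real p powr -2) \<le> (\<Sum>\<^sub>\<infinity>n. real n powr -2)"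
      by (intro finite_sum_le_infsum powr_summable_on) auto
    then show ?thesis
      by (simp add: exp_sum[symmetric] sum_negf sum_distrib_left[symmetric] mult_left_mono)
  qed
  moreover have "0 \<le> (\<Prod>p | prime p \<and> p \<le> y. a p)"
    by (intro prod_nonneg) (auto intro: a_nonneg)
  ultimately have "(\<Prod>p | prime p \<and> p \<le> y \<and> [p = 1] (mod q). 1 - 1 / real p) ^ (q - 1) *
      exp (- (real (q - 1) * (\<Sum>\<^sub>\<infinity>n. real n powr -2))) \<le>
      (\<Prod>p | prime p \<and> p \<le> y. a p) * (\<Prod>p | prime p \<and> p \<le> y. exp (- (real (q - 1) * real p powr -2)))"
    by (simp add: mult_left_mono)
  also have "\<dots> = (\<Prod>p | prime p \<and> p \<le> y. a p * exp (- (real (q - 1) * real p powr -2)))"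
    by (simp add: prod.distrib)
  also have "\<dots> \<le> Euler_product s y"
    unfolding Euler_product_def
  proof (rule prod_mono, intro conjI)
    fix p assume "p \<in> {p. prime p \<and> p \<le> y}"
    then have p: "prime p" by simp
    note b = prime_powr_bounds[OF p s]
    show "0 \<le> a p * exp (- (real (q - 1) * real p powr -2))"
      using a_nonneg[OF p] by simp
    show "a p * exp (- (real (q - 1) * real p powr -2)) \<le> norm (\<Prod>j\<in>{1..q-1}. 1 - term_at j s p)"
    proof (cases "[p = 1] (mod q)")
      case True
      then have w1: "w p = 1" using w_eq_1_iff by simp
      have "norm (1 - complex_of_real (real p powr - s))
          = norm (complex_of_real (1 - real p powr - s))" by simp
      also have "\<dots> = 1 - real p powr - s"
        unfolding norm_of_real using b by linarith
      finally have n1: "norm (1 - complex_of_real (real p powr - s)) = 1 - real p powr - s" .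
      have "norm (\<Prod>j\<in>{1..q-1}. 1 - term_at j s p) = (1 - real p powr - s) ^ (q - 1)"
        unfolding local_factor_eq w1 by (simp add: norm_power n1)
      moreover have "(1 - 1 / real p) ^ (q - 1) \<le> (1 - real p powr - s) ^ (q - 1)"
        using b p by (intro power_mono) (auto intro: prime_inverse_le_1)
      moreover have "a p * exp (- (real (q - 1) * real p powr -2)) \<le> a p * 1"
        using a_nonneg[OF p] by (intro mult_left_mono) auto
      ultimately show ?thesis using True by (simp add: a_def)
    next
      case False
      then have a1: "a p = 1" by (simp add: a_def)
      show ?thesis
      proof (cases "p = q")
        case True
        then show ?thesis using local_factor_dvd a1 by simp
      next
        case pq: False
        then have nd: "\<not> q dvd p" using p prime_q primes_dvd_imp_eq by blast
        have "(real p powr - s)\<^sup>2 \<le> (1 / real p)\<^sup>2" using b by (intro power_mono) auto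
        also have "\<dots> = real p powr -2"
          using p prime_gt_0_nat[OF p] by (simp add: powr_minus power_divide divide_inverse
              power_inverse powr_numeral)
        finally have "real (q - 1) * (real p powr - s)\<^sup>2 \<le> real (q - 1) * real p powr -2"
          by (intro mult_left_mono) auto
        then have "exp (- (real (q - 1) * real p powr -2))
            \<le> exp (- (real (q - 1) * (real p powr - s)\<^sup>2))"
          by simp
        also have "\<dots> \<le> norm (\<Prod>j\<in>{1..q-1}. 1 - term_at j s p)"
          unfolding local_factor_eq
          by (rule root_of_unity_product_ge) (use w_root[OF nd] w_eq_1_iff[of p] False q_gt_1 b in
              auto)
        finally show ?thesis by (simp add: a1)
      qed
    qed
  qed
  finally show ?thesis .
qed

end

text \<open>The two bounds for \<open>Euler_product\<close> are compared at
  \<open>s = 1 + 1 / sqrt (ln y)\<close>. Taking the root of order \<open>q - 1\<close> gives the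
  exponent \<open>1 / (2 * (q - 1))\<close>.\<close>

theorem prime_product_cong_1_decay:
  assumes "prime q"
  shows "\<exists>C>0. \<exists>\<delta>>0. \<forall>\<^sub>F y in sequentially.
           (\<Prod>p | prime p \<and> p \<le> y \<and> [p = 1] (mod q). 1 - 1 / real p) \<le> C * ln (real y) powr - \<delta>"
proof -
  obtain w where "prime_character_generator q w"
    using prime_character_generator_exists[OF assms] by blast
  then interpret prime_character_generator q w .
  define N where "N = q - 1"
  have N: "N > 0" using q_gt_1 by (simp add: N_def)
  define P where "P y = (\<Prod>p | prime p \<and> p \<le> y \<and> [p = 1] (mod q). 1 - 1 / real p)" for y
  obtain C0 where C0: "C0 > 0" and ev: "\<forall>\<^sub>F s in at_right 1. \<forall>y\<ge>1. real y powr (1 - s) / (s - 1)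
      \<le> 1 \<longrightarrow> Euler_product s y \<le> C0 * (s - 1)"
    using Euler_product_upper by blast
  define c where "c = exp (- (real N * (\<Sum>\<^sub>\<infinity>n. real n powr -2)))"
  have c: "c > 0" by (simp add: c_def)
  have "filterlim (\<lambda>y. 1 + 1 / sqrt (ln (real y))) (at_right 1) sequentially" by real_asymp
  then have ev1: "\<forall>\<^sub>F y in sequentially. \<forall>z\<ge>1. real z powr (1 - (1
      + 1 / sqrt (ln (real y)))) / ((1 + 1 / sqrt (ln (real y))) - 1) \<le> 1 \<longrightarrow>
      Euler_product (1 + 1 / sqrt (ln (real y))) z \<le> C0 * ((1 + 1 / sqrt (ln (real y))) - 1)"
    using ev by (rule eventually_compose_filterlim[rotated])
  \<comment> \<open>For this \<open>s\<close> the left side equals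
    \<open>exp (- sqrt (ln y)) * sqrt (ln y)\<close>, which tends to 0.\<close>
  have ev2: "\<forall>\<^sub>F y in sequentially. real y powr (1 - (1 + 1 / sqrt (ln (real y)))) / ((1
      + 1 / sqrt (ln (real y))) - 1) \<le> 1"
    by real_asymp
  have ev3: "\<forall>\<^sub>F y in sequentially. ln (real y) > 0" by real_asymp
  have "\<forall>\<^sub>F y in sequentially. P y \<le> (C0 / c) powr (1 / N) * ln (real y) powr - (1 / (2 * N))"
    using ev1 ev2 ev3 eventually_ge_at_top[of 1]
  proof eventually_elim
    case (elim y)
    define s where "s = 1 + 1 / sqrt (ln (real y))"
    have s: "s > 1" using elim by (simp add: s_def)
    have P0: "P y \<ge> 0" unfolding P_def by (intro prod_nonneg) (auto intro: prime_inverse_le_1)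
    have "P y ^ N * c \<le> Euler_product s y"
      using Euler_product_lower[OF s, of y] by (simp add: P_def c_def N_def)
    also have "\<dots> \<le> C0 * (s - 1)" using elim by (simp add: s_def)
    also have "s - 1 = ln (real y) powr - (1 / 2)"
      using elim(3) by (simp only: s_def powr_minus powr_half_sqrt less_imp_le inverse_eq_divide
          add_diff_cancel_left')
    finally have "P y ^ N \<le> (C0 / c) * ln (real y) powr - (1 / 2)"
        using c by (simp add: field_simps)
    then have "(P y ^ N) powr (1 / N) \<le> ((C0 / c) * ln (real y) powr - (1 / 2)) powr (1 / N)"
      using P0 by (intro powr_mono2) auto
    also have "(P y ^ N) powr (1 / N) = P y"
    proof (cases "P y = 0")
      case False
      then have "P y > 0" using P0 by simp
      then show ?thesis using N by (simp add: powr_powr flip: powr_realpow)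
    qed (use N in \<open>simp add: zero_power\<close>)
    also have "((C0 / c) * ln (real y) powr - (1 / 2)) powr (1 / N)
        = (C0 / c) powr (1 / N) * ln (real y) powr - (1 / (2 * N))"
      using C0 c by (subst powr_mult) (simp_all add: powr_powr)
    finally show ?case .
  qed
  moreover have "(C0 / c) powr (1 / N) > 0" "1 / (2 * real N) > 0" using C0 c N by auto
  ultimately show ?thesis
    unfolding P_def[symmetric] by (intro exI[of _ "(C0 / c) powr (1 / N)"] exI[of _ "1 / (2
        * real N)"] conjI) auto
qed

section \<open>Sieving and iterated totients\<close>

text \<open>Induction on \<open>P\<close>: the multiples of a new prime \<open>p\<close> correspond
  to the sieved integers up to \<open>x / p\<close>, so the error at most doubles. Hence
  \<open>x\<close> has to vary over the reals in the induction.\<close>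

lemma Legendre_sieve:
  assumes "finite P" and "\<And>p. p \<in> P \<Longrightarrow> prime p" and "x \<ge> 0"
  shows "\<bar>real (card {n. 0 < n \<and> real n \<le> x \<and> (\<forall>p\<in>P. \<not> p dvd n)}) - x * (\<Prod>p\<in>P. 1 - 1 / real p)\<bar>
      \<le> 2 ^ card P"
  using assms
proof (induction P arbitrary: x rule: finite_induct)
  case empty
  have "{n. 0 < n \<and> real n \<le> x} = {1..nat \<lfloor>x\<rfloor>}"
    using empty by (auto simp: le_nat_floor nat_le_iff le_floor_iff) linarith
  then have "real (card {n. 0 < n \<and> real n \<le> x}) = of_int \<lfloor>x\<rfloor>" using empty by simp
  then show ?case by simp linarith
next
  case (insert p P)
  define A where "A Q x = {n. 0 < n \<and> real n
      \<le> x \<and> (\<forall>p\<in>Q. \<not> p dvd n)}" for Q :: "nat set" and x :: real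
  have p: "prime p" and p0: "p > 0" using insert by (auto simp: prime_gt_0_nat)
  have finA: "finite (A Q x)" for Q x
    by (rule finite_subset[of _ "{..nat \<lfloor>x\<rfloor>}"]) (auto simp: A_def le_nat_floor)
  have ndvd: "r dvd p * n \<longleftrightarrow> r dvd n" if "r \<in> P" for r n
  proof -
    have "prime r" "r \<noteq> p" using insert that by auto
    then show ?thesis using p by (auto simp: prime_dvd_mult_iff primes_dvd_imp_eq)
  qed
  have eq: "A P x = A (insert p P) x \<union> (\<lambda>n. p * n) ` A P (x / p)"
  proof (intro equalityI subsetI)
    fix n assume n: "n \<in> A P x"
    show "n \<in> A (insert p P) x \<union> (\<lambda>n. p * n) ` A P (x / p)"
    proof (cases "p dvd n")
      case True
      then obtain m where m: "n = p * m" by auto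
      then have "m \<in> A P (x / p)"
        using n p0 ndvd by (auto simp: A_def field_simps)
      then show ?thesis using m by auto
    qed (use n in \<open>auto simp: A_def\<close>)
  next
    fix n assume "n \<in> A (insert p P) x \<union> (\<lambda>n. p * n) ` A P (x / p)"
    then show "n \<in> A P x" using p0 ndvd by (auto simp: A_def field_simps)
  qed
  have "card (A P x) = card (A (insert p P) x) + card ((\<lambda>n. p * n) ` A P (x / p))"
    unfolding eq by (rule card_Un_disjoint[OF finA finite_imageI[OF finA]]) (auto simp: A_def)
  also have "card ((\<lambda>n. p * n) ` A P (x / p)) = card (A P (x / p))"
    by (rule card_image) (use p0 in \<open>auto intro: inj_onI\<close>)
  finally have c: "real (card (A (insert p P) x))
      = real (card (A P x)) - real (card (A P (x / p)))" by simp
  define \<pi> where "\<pi> = (\<Prod>p\<in>P. 1 - 1 / real p)"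
  have "\<bar>real (card (A P x)) - x * \<pi>\<bar> \<le> 2 ^ card P" "\<bar>real (card (A P (x / p))) - x / p * \<pi>\<bar>
      \<le> 2 ^ card P"
    using insert.IH[of x] insert.IH[of "x / p"] insert.prems by (simp_all add: A_def \<pi>_def)
  moreover have "x * (\<Prod>r\<in>insert p P. 1 - 1 / real r) = x * \<pi> - x / p * \<pi>"
    using insert.hyps by (simp add: \<pi>_def algebra_simps)
  moreover have "\<bar>a - b - (u - v)\<bar> \<le> 2 * t" if "\<bar>a - u\<bar> \<le> t" "\<bar>b - v\<bar> \<le> t" for a b u v t :: real
    using that by linarith
  ultimately have "\<bar>real (card (A (insert p P) x)) - x * (\<Prod>r\<in>insert p P. 1 - 1 / real r)\<bar>
      \<le> 2 * 2 ^ card P"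
    unfolding c by metis
  then show ?case using insert.hyps by (simp add: A_def)
qed

section \<open>Totients and their iterates\<close>

lemma totient_le_prod:
  assumes S: "finite S" "\<And>r. r \<in> S \<Longrightarrow> prime r \<and> r dvd n" and n: "n > 0"
  shows "real (totient n) \<le> real n * (\<Prod>r\<in>S. 1 - 1 / real r)"
proof -
  have sub: "S \<subseteq> prime_factors n" using S n by (auto simp: prime_factors_dvd)
  have "(\<Prod>r\<in>prime_factors n. 1 - 1 / real r)
      = (\<Prod>r\<in>prime_factors n - S. 1 - 1 / real r) * (\<Prod>r\<in>S. 1 - 1 / real r)"
    by (rule prod.subset_diff[OF sub]) simp
  also have "\<dots> \<le> 1 * (\<Prod>r\<in>S. 1 - 1 / real r)"
    by (intro mult_right_mono prod_nonneg prod_le_1) (use S in \<open>auto intro: prime_inverse_le_1\<close>)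
  finally have "real n * (\<Prod>r\<in>prime_factors n. 1 - 1 / real r) \<le> real n * (\<Prod>r\<in>S. 1 - 1 / real r)"
    by (intro mult_left_mono) auto
  then show ?thesis using totient_formula2[of n] by simp
qed

lemma dvd_totient_if_prime_cong_1:
  assumes "prime p" "p dvd n" "[p = 1] (mod r)"
  shows "r dvd totient n"
proof -
  have "r dvd p - 1" using assms cong_to_1_nat by blast
  also have "p - 1 = totient p" using assms by (simp add: totient_prime)
  also have "totient p dvd totient n" using assms totient_dvd by blast
  finally show ?thesis .
qed

lemma totient_iter_Suc: "totient_iter (Suc k) n = totient (totient_iter k n)"
  by (simp add: totient_iter_def)

lemma totient_iter_le:
  assumes "k \<ge> m"
  shows "totient_iter k n \<le> totient_iter m n"
  using assms
proof (induction k rule: dec_induct)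
  case (step k)
  then show ?case using totient_le[of "totient_iter k n"] by (simp add: totient_iter_Suc)
qed simp

lemma totient_le_half:
  assumes "even n"
  shows "2 * totient n \<le> n"
proof (cases "n = 0")
  case False
  then show ?thesis using totient_le_prod[of "{2}" n] assms by simp
qed simp

text \<open>A positive totient is 1 or even, so each further step at least halves it until 1 is reached.\<close>

lemma totient_iter_halving:
  "totient_iter (Suc k) n \<le> 1 \<or> 2 ^ k * totient_iter (Suc k) n \<le> n \<and> even (totient_iter (Suc k) n)"
proof (induction k)
  case 0
  have t: "totient_iter (Suc 0) n = totient n" by (simp add: totient_iter_def)
  show ?case
  proof (cases "n \<le> 2")
    case True
    then have "n = 0 \<or> n = 1 \<or> n = 2" by auto
    then show ?thesis unfolding t by auto
  next
    case False
    then show ?thesis unfolding t using totient_le[of n] totient_even[of n] by simp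
  qed
next
  case (Suc k)
  define m where "m = totient_iter (Suc k) n"
  show ?case
  proof (cases "m \<le> 2")
    case True
    then have "m = 0 \<or> m = 1 \<or> m = 2" by auto
    then have "totient m \<le> 1" by auto
    then show ?thesis by (simp add: totient_iter_Suc[of "Suc k"] m_def)
  next
    case False
    then have m: "even m" "2 ^ k * m \<le> n" using Suc by (auto simp: m_def)
    have "2 ^ Suc k * totient m = 2 ^ k * (2 * totient m)" by simp
    also have "\<dots> \<le> 2 ^ k * m" by (intro mult_le_mono2 totient_le_half m)
    also note m(2)
    finally have "2 ^ Suc k * totient m \<le> n" .
    then show ?thesis using totient_even[of m] False
      by (simp add: totient_iter_Suc[of "Suc k"] m_def[symmetric])
  qed
qed

section \<open>Integers without small prime factors congruent to 1\<close>

text \<open>Only primes up to the cutoff \<open>y\<close> are excluded, so that the sieve meets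
  finitely many primes.\<close>

definition no_prime_factor_cong_1 :: "nat \<Rightarrow> nat \<Rightarrow> real \<Rightarrow> nat set" where
  "no_prime_factor_cong_1 q y x =
     {n. 0 < n \<and> real n \<le> x \<and> (\<forall>p\<in>{p. prime p \<and> p \<le> y \<and> [p = 1] (mod q)}. \<not> p dvd n)}"

lemma finite_no_prime_factor_cong_1: "finite (no_prime_factor_cong_1 q y x)"
  by (rule finite_subset[of _ "{..nat \<lfloor>x\<rfloor>}"]) (auto simp: no_prime_factor_cong_1_def le_nat_floor)

lemma card_no_prime_factor_cong_1_le:
  assumes "x \<ge> 0"
  shows "real (card (no_prime_factor_cong_1 q y x)) \<le>
    x * (\<Prod>p | prime p \<and> p \<le> y \<and> [p = 1] (mod q). 1 - 1 / real p) + 2 ^ y"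
proof -
  define P where "P = {p. prime p \<and> p \<le> y \<and> [p = 1] (mod q)}"
  have P: "finite P" "\<And>p. p \<in> P \<Longrightarrow> prime p" by (auto simp: P_def)
  have "P \<subseteq> {1..y}" by (auto simp: P_def Suc_le_eq prime_gt_0_nat)
  then have "card P \<le> y" using card_mono[of "{1..y}" P] by simp
  then have "(2 :: real) ^ card P \<le> 2 ^ y" by (intro power_increasing) auto
  then show ?thesis using Legendre_sieve[OF P assms]
    unfolding no_prime_factor_cong_1_def P_def[symmetric] by linarith
qed

text \<open>The cutoff \<open>ln x\<close> is low enough for the exponential sieve error to save a
  power of \<open>x\<close>, yet high enough for the prime product to decay like a power of
  \<open>ln (ln x)\<close>.\<close>

lemma no_prime_factor_cong_1_small:
  assumes "prime q"
  shows "\<exists>C>0. \<exists>\<delta>>0. \<forall>\<^sub>F x in at_top.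
    real (card (no_prime_factor_cong_1 q (nat \<lfloor>ln x\<rfloor>) x)) \<le> C * x * ln (ln x) powr - \<delta>"
proof -
  obtain C \<delta> where C: "C > 0" "\<delta> > 0" and ev: "\<forall>\<^sub>F y in sequentially.
      (\<Prod>p | prime p \<and> p \<le> y \<and> [p = 1] (mod q). 1 - 1 / real p) \<le> C * ln (real y) powr - \<delta>"
    using prime_product_cong_1_decay[OF assms] by blast
  have "filterlim (\<lambda>x::real. nat \<lfloor>ln x\<rfloor>) sequentially at_top"
    by (intro filterlim_compose[OF filterlim_nat_sequentially] filterlim_compose[OF
        filterlim_floor_sequentially] ln_at_top)
  then have ev1: "\<forall>\<^sub>F x::real in at_top. (\<Prod>p | prime p \<and> p
      \<le> nat \<lfloor>ln x\<rfloor> \<and> [p = 1] (mod q). 1 - 1 / real p)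
      \<le> C * ln (real (nat \<lfloor>ln x\<rfloor>)) powr - \<delta>"
    using ev by (rule eventually_compose_filterlim[rotated])
  have ev2: "\<forall>\<^sub>F x::real in at_top. ln (ln x) / 2 \<le> ln (ln x - 1)" by real_asymp
  have ev3: "\<forall>\<^sub>F x::real in at_top. x powr (3/4) \<le> x * ln (ln x) powr - \<delta>"
    using C(2) by real_asymp
  have ev4: "\<forall>\<^sub>F x::real in at_top. ln (ln x) > 0 \<and> ln x > 2 \<and> x > 0"
    by (intro eventually_conj; real_asymp)
  have "\<forall>\<^sub>F x in at_top. real (card (no_prime_factor_cong_1 q (nat \<lfloor>ln x\<rfloor>) x))
      \<le> (C * 2 powr \<delta> + 1) * x * ln (ln x) powr - \<delta>"
    using ev1 ev2 ev3 ev4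
  proof eventually_elim
    case (elim x)
    have x: "x > 0" "ln x > 2" "ln (ln x) > 0" using elim by auto
    define y where "y = nat \<lfloor>ln x\<rfloor>"
    have y: "real y \<ge> ln x - 1" "real y \<le> ln x" unfolding y_def using x by linarith+
    have "ln (ln x - 1) \<le> ln (real y)" using y x by (subst ln_le_cancel_iff) auto
    then have "ln (ln x) / 2 \<le> ln (real y)" using elim(2) by linarith
    then have "ln (real y) powr - \<delta> \<le> (ln (ln x) / 2) powr - \<delta>"
      using x C by (intro powr_mono2') auto
    also have "\<dots> = 2 powr \<delta> * ln (ln x) powr - \<delta>"
      using x by (simp add: powr_divide powr_minus field_simps)
    finally have "C * ln (real y) powr - \<delta> \<le> C * (2 powr \<delta> * ln (ln x) powr - \<delta>)"
      using C by (intro mult_left_mono) auto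
    with elim(1) have "(\<Prod>p | prime p \<and> p \<le> y \<and> [p = 1] (mod q). 1 - 1 / real p)
        \<le> C * (2 powr \<delta> * ln (ln x) powr - \<delta>)"
      unfolding y_def by linarith
    then have "x * (\<Prod>p | prime p \<and> p \<le> y \<and> [p = 1] (mod q). 1 - 1 / real p)
        \<le> x * (C * (2 powr \<delta> * ln (ln x) powr - \<delta>))"
      using x by (intro mult_left_mono) auto
    \<comment> \<open>The error is at most \<open>2 powr ln x = x powr ln 2\<close>, and
      \<open>ln 2 \<le> 25/36 < 3/4\<close>.\<close>
    moreover have "(2::real) ^ y \<le> x * ln (ln x) powr - \<delta>"
    proof -
      have "(2::real) ^ y = 2 powr real y" by (simp add: powr_realpow)
      also have "\<dots> \<le> 2 powr ln x" using y by (intro powr_mono) auto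
      also have "\<dots> = x powr ln 2" using x by (simp add: powr_def mult.commute)
      also have "\<dots> \<le> x powr (3/4)"
        using x ln2_le_25_over_36 ln_gt_zero_iff[of x] by (intro powr_mono) linarith+
      finally show ?thesis using elim(3) by linarith
    qed
    ultimately have "real (card (no_prime_factor_cong_1 q y x))
        \<le> x * (C * (2 powr \<delta> * ln (ln x) powr - \<delta>)) + x * ln (ln x) powr - \<delta>"
      using card_no_prime_factor_cong_1_le[of x q y] x by linarith
    also have "\<dots> = (C * 2 powr \<delta> + 1) * x * ln (ln x) powr - \<delta>" by (simp add: algebra_simps)
    finally show ?case by (simp add: y_def)
  qed
  moreover have "C * 2 powr \<delta> + 1 > 0" using C by (simp add: add_pos_pos)
  ultimately show ?thesis using C by blast
qed

text \<open>The decay theorem for the modulus 2, where the residue class 1 consists of the odd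
  primes.\<close>

lemma prime_product_eventually_small:
  fixes c :: real
  assumes "c > 0"
  shows "\<exists>Q. (\<Prod>p | prime p \<and> p \<le> Q \<and> [p = 1] (mod 2). 1 - 1 / real p) < c"
proof -
  obtain C \<delta> where C: "C > 0" "\<delta> > 0" and ev: "\<forall>\<^sub>F y in sequentially.
      (\<Prod>p | prime p \<and> p \<le> y \<and> [p = 1] (mod 2). 1 - 1 / real p) \<le> C * ln (real y) powr - \<delta>"
    using prime_product_cong_1_decay[OF two_is_prime_nat] by blast
  have "(\<lambda>y. C * ln (real y) powr - \<delta>) \<longlonglongrightarrow> 0" using C by real_asymp
  then have "\<forall>\<^sub>F y in sequentially. C * ln (real y) powr - \<delta> < c"
      using assms by (rule order_tendstoD)
  with ev have "\<forall>\<^sub>F y in sequentially. (\<Prod>p | prime p \<and> p \<le> y \<and> [p = 1] (mod 2). 1 - 1 / real p) < c"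
    by eventually_elim linarith
  then show ?thesis by (auto simp: eventually_sequentially)
qed

section \<open>Counting integers with a large iterate\<close>

text \<open>For \<open>n\<close> outside the union, each odd prime \<open>r \<le> Q\<close> has a
  prime factor of \<open>n\<close> congruent to 1 modulo \<open>r\<close>, hence divides
  \<open>totient n\<close>. The second totient then loses the whole product and falls below
  \<open>c * n\<close>.\<close>

lemma second_iterate_large_subset:
  fixes c :: real
  assumes c: "c > 0" and Q: "(\<Prod>p | prime p \<and> p \<le> Q \<and> [p = 1] (mod 2). 1 - 1 / real p) < c"
    and k: "k \<ge> 1"
  shows "{n. 0 < n \<and> real n \<le> x \<and> c * real n \<le> real (totient_iter (k + 1) n)} \<subseteq>
    (\<Union>q\<in>{q. prime q \<and> q \<le> Q}. no_prime_factor_cong_1 q y x)"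
proof
  fix n assume n: "n \<in> {n. 0 < n \<and> real n \<le> x \<and> c * real n \<le> real (totient_iter (k + 1) n)}"
  show "n \<in> (\<Union>q\<in>{q. prime q \<and> q \<le> Q}. no_prime_factor_cong_1 q y x)"
  proof (rule ccontr)
    assume out: "n \<notin> (\<Union>q\<in>{q. prime q \<and> q \<le> Q}. no_prime_factor_cong_1 q y x)"
    define S where "S = {p. prime p \<and> p \<le> Q \<and> [p = 1] (mod 2)}"
    have S: "prime r \<and> r dvd totient n" if "r \<in> S" for r
    proof -
      have r: "prime r" "r \<le> Q" using that by (auto simp: S_def)
      then obtain p where "prime p" "p dvd n" "[p = 1] (mod r)"
        using out n by (auto simp: no_prime_factor_cong_1_def)
      then show ?thesis using r dvd_totient_if_prime_cong_1 by blast
    qed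
    have "real (totient_iter (k + 1) n) \<le> real (totient_iter 2 n)"
      using totient_iter_le[of 2 "k + 1" n] k by simp
    also have "totient_iter 2 n = totient (totient n)"
        by (simp add: totient_iter_def numeral_2_eq_2)
    also have "real (totient (totient n)) \<le> real (totient n) * (\<Prod>r\<in>S. 1 - 1 / real r)"
      by (rule totient_le_prod[OF _ S]) (use n in \<open>auto simp: S_def\<close>)
    also have "\<dots> \<le> real n * (\<Prod>r\<in>S. 1 - 1 / real r)"
      using totient_le[of n]
      by (intro mult_right_mono prod_nonneg) (auto simp: S_def intro: prime_inverse_le_1)
    also have "\<dots> < real n * c" using Q n unfolding S_def by (intro mult_strict_left_mono) auto
    finally show False using n by (simp add: mult.commute)
  qed
qed

lemma powr_decay_le_ln_power:
  fixes \<delta> B :: real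
  assumes "\<delta> > 0" "B > 0"
  shows "\<forall>\<^sub>F u in at_top. u powr - \<delta> \<le> B / ln u ^ m"
proof -
  have "((\<lambda>u. ln u powr real m * u powr - \<delta>) \<longlongrightarrow> 0) at_top"
    using assms by real_asymp
  then have "\<forall>\<^sub>F u in at_top. ln u powr real m * u powr - \<delta> < B"
    using assms by (intro order_tendstoD) auto
  moreover have "\<forall>\<^sub>F u::real in at_top. ln u > 0" by real_asymp
  ultimately show ?thesis
    by eventually_elim (simp add: powr_realpow field_simps)
qed

text \<open>Finitely many \<open>q \<le> Q\<close> are involved, and each set is smaller than
  \<open>x\<close> by a power of \<open>ln (ln x)\<close>, which beats any power of
  \<open>ln (ln (ln x))\<close> with any constant \<open>B\<close>.\<close>

lemma card_large_iterate_le: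
  fixes c B :: real
  assumes c: "c > 0" and B: "B > 0" and k: "k \<ge> 1"
  shows "\<forall>\<^sub>F x in at_top.
    real (card {n. 0 < n \<and> real n \<le> x \<and> c * real n \<le> real (totient_iter (k + 1) n)})
        \<le> B * (x / ln (ln (ln x)) ^ m)"
proof -
  obtain Q where Q: "(\<Prod>p | prime p \<and> p \<le> Q \<and> [p = 1] (mod 2). 1 - 1 / real p) < c"
    using prime_product_eventually_small[OF c] by blast
  define R where "R = {q. prime q \<and> q \<le> Q}"
  \<comment> \<open>An equal share of \<open>B\<close> for each modulus; adding 1 keeps the
    denominator positive even if \<open>R\<close> is empty.\<close>
  define a where "a = B / (real (card R) + 1)"
  have a: "a > 0" using B by (simp add: a_def)
  have finR: "finite R" by (simp add: R_def)
  have "\<forall>\<^sub>F x in at_top. real (card (no_prime_factor_cong_1 q (nat \<lfloor>ln x\<rfloor>) x))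
      \<le> a * (x / ln (ln (ln x)) ^ m)"
    if q: "q \<in> R" for q
  proof -
    obtain C \<delta> where C: "C > 0" "\<delta> > 0"
      and ev: "\<forall>\<^sub>F x in at_top. real (card (no_prime_factor_cong_1 q (nat \<lfloor>ln x\<rfloor>) x))
          \<le> C * x * ln (ln x) powr - \<delta>"
      using no_prime_factor_cong_1_small[of q] q unfolding R_def by blast
    have "a / C > 0" using a C by simp
    have "filterlim (\<lambda>x::real. ln (ln x)) at_top at_top" by real_asymp
    then have "\<forall>\<^sub>F x::real in at_top. ln (ln x) powr - \<delta> \<le> a / C / ln (ln (ln x)) ^ m"
      using powr_decay_le_ln_power[OF C(2) \<open>a / C > 0\<close>, of m]
          by (rule eventually_compose_filterlim[rotated])
    then show ?thesis using ev eventually_gt_at_top[of 0]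
    proof eventually_elim
      case (elim x)
      have "C * x * ln (ln x) powr - \<delta> \<le> C * x * (a / C / ln (ln (ln x)) ^ m)"
        using elim C by (intro mult_left_mono) auto
      also have "\<dots> = a * (x / ln (ln (ln x)) ^ m)" using C by simp
      finally show ?case using elim by linarith
    qed
  qed
  then have "\<forall>\<^sub>F x in at_top. \<forall>q\<in>R. real (card (no_prime_factor_cong_1 q (nat \<lfloor>ln x\<rfloor>) x))
      \<le> a * (x / ln (ln (ln x)) ^ m)"
    using finR by (intro eventually_ball_finite) auto
  moreover have "\<forall>\<^sub>F x::real in at_top. x > 0 \<and> ln (ln (ln x)) > 0"
    by (intro eventually_conj; real_asymp)
  ultimately show ?thesis
  proof eventually_elim
    case (elim x)
    define y where "y = nat \<lfloor>ln x\<rfloor>"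
    have pos: "x / ln (ln (ln x)) ^ m \<ge> 0" using elim by simp
    have "card {n. 0 < n \<and> real n \<le> x \<and> c * real n \<le> real (totient_iter (k + 1) n)}
        \<le> card (\<Union>q\<in>R. no_prime_factor_cong_1 q y x)"
      using second_iterate_large_subset[OF c Q k, of x y] finR
      by (intro card_mono) (auto simp: R_def finite_no_prime_factor_cong_1)
    also have "\<dots> \<le> (\<Sum>q\<in>R. card (no_prime_factor_cong_1 q y x))"
      by (rule card_UN_le[OF finR])
    finally have "real (card {n. 0 < n \<and> real n \<le> x \<and> c * real n \<le> real (totient_iter (k + 1) n)})
        \<le> real (\<Sum>q\<in>R. card (no_prime_factor_cong_1 q y x))"
      by (rule of_nat_mono)
    also have "\<dots> = (\<Sum>q\<in>R. real (card (no_prime_factor_cong_1 q y x)))" by simp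
    also have "\<dots> \<le> (\<Sum>q\<in>R. a * (x / ln (ln (ln x)) ^ m))"
      by (intro sum_mono) (use elim in \<open>auto simp: y_def\<close>)
    also have "\<dots> = (real (card R) * a) * (x / ln (ln (ln x)) ^ m)" by simp
    also have "\<dots> \<le> B * (x / ln (ln (ln x)) ^ m)"
      by (intro mult_right_mono pos) (use B in \<open>simp add: a_def field_simps\<close>)
    finally show ?case .
  qed
qed

text \<open>Halving would push the iterate below \<open>c * n\<close>, so the iterate is at most 1
  and \<open>n \<le> 1 / c\<close>.\<close>

lemma card_large_iterate_le_inverse:
  fixes c :: real
  assumes c: "c > 0" and k: "(1 / 2) ^ k < c"
  shows "real (card {n. 0 < n \<and> real n \<le> x \<and> c * real n \<le> real (totient_iter (k + 1) n)}) \<le> 1 / c"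
proof -
  have "{n. 0 < n \<and> real n \<le> x \<and> c * real n \<le> real (totient_iter (k + 1) n)} \<subseteq> {1..nat \<lfloor>1 / c\<rfloor>}"
  proof
    fix n assume n: "n \<in> {n. 0 < n \<and> real n \<le> x \<and> c * real n \<le> real (totient_iter (k + 1) n)}"
    have "\<not> 2 ^ k * totient_iter (k + 1) n \<le> n"
    proof
      assume "2 ^ k * totient_iter (k + 1) n \<le> n"
      then have "real (2 ^ k * totient_iter (k + 1) n) \<le> real n" by (rule of_nat_mono)
      then have "real (totient_iter (k + 1) n) \<le> (1 / 2) ^ k * real n" by (simp add: field_simps)
      also have "\<dots> < c * real n" using k n by (intro mult_strict_right_mono) auto
      finally show False using n by simp
    qed
    then have "totient_iter (k + 1) n \<le> 1" using totient_iter_halving[of k n] by simp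
    then have "c * real n \<le> 1" using n by force
    then have "real n \<le> 1 / c" using c by (simp add: field_simps)
    then show "n \<in> {1..nat \<lfloor>1 / c\<rfloor>}" using n by (auto simp: le_nat_floor)
  qed
  then have "card {n. 0 < n \<and> real n \<le> x \<and> c * real n \<le> real (totient_iter (k + 1) n)}
      \<le> nat \<lfloor>1 / c\<rfloor>"
    using card_mono[of "{1..nat \<lfloor>1 / c\<rfloor>}"] by fastforce
  also have "real (nat \<lfloor>1 / c\<rfloor>) \<le> 1 / c" using c by simp
  finally show ?thesis by simp
qed

theorem theorem1:
  fixes c c1 :: real
  assumes "0 < c" and "c < 1 / 2"
    and "0 < c1" and "c1 \<le> 1"
  shows "\<exists>C>0. \<forall>\<^sub>F x :: real in at_top. \<forall>k :: nat.
    1 \<le> k \<and> real k \<le> ln_iter 2 x / ln_iter 4 x \<longrightarrow>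
      real (card {n :: nat. 0 < n \<and> real n \<le> x \<and> c * real n \<le> real (totient_iter (k + 1) n)})
        \<le> 6 / (fact (k - 1) * exp ((real k - 1) * euler_mascheroni) * pi ^ 2)
             * (x / (c * ln_iter 3 x ^ (k + 1)))
           + C * (x * exp ((ln_iter 3 x) ^ 2) / (ln x powr c1 * (ln_iter 3 x) ^ 2))"
proof -
  have l3: "ln_iter 3 x = ln (ln (ln x))" for x
    by (simp add: ln_iter_def numeral_3_eq_3)
  define count where "count k x = real (card {n :: nat. 0 < n \<and> real n \<le> x \<and> c * real n
      \<le> real (totient_iter (k + 1) n)})"
    for k :: nat and x :: real
  define A where "A k = 6 / (fact (k - 1) * exp ((real k - 1) * euler_mascheroni)
      * pi ^ 2)" for k :: nat
  define main where "main k x = A k * (x / (c * ln_iter 3 x ^ (k + 1)))" for k :: nat and x :: real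
  define err where "err x = x * exp ((ln_iter 3 x) ^ 2) / (ln x powr c1
      * (ln_iter 3 x) ^ 2)" for x :: real
  have A: "A k > 0" for k by (simp add: A_def)
  \<comment> \<open>\<open>K\<close> depends only on \<open>c\<close>. Up to \<open>K\<close> the
    main term alone suffices, and uniformity in \<open>k\<close> is automatic for finitely many
    values; beyond \<open>K\<close> the error term absorbs at most \<open>1 / c\<close>
    integers.\<close>
  obtain K where K: "(1 / 2) ^ K < c"
    using real_arch_pow_inv[of c "1 / 2"] assms by auto
  have "\<forall>\<^sub>F x in at_top. \<forall>k\<in>{1..K}. count k x \<le> main k x"
  proof (intro eventually_ball_finite ballI)
    fix k assume k: "k \<in> {1..K}"
    \<comment> \<open>The arbitrary constant is taken to be \<open>A k / c\<close>, which makes the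
      bound exactly the main term.\<close>
    then have "\<forall>\<^sub>F x in at_top. count k x \<le> A k / c * (x / ln (ln (ln x)) ^ (k + 1))"
      unfolding count_def using A assms by (intro card_large_iterate_le) auto
    then show "\<forall>\<^sub>F x in at_top. count k x \<le> main k x"
      by (simp add: main_def l3)
  qed simp
  moreover have "\<forall>\<^sub>F x in at_top. (1 / c) * ln x powr c1 \<le> x"
    using assms by real_asymp
  moreover have "\<forall>\<^sub>F x::real in at_top. x > 0 \<and> ln x > 0 \<and> ln (ln (ln x)) > 0"
    by (intro eventually_conj; real_asymp)
  ultimately have "\<forall>\<^sub>F x in at_top. \<forall>k. 1 \<le> k \<longrightarrow> count k x \<le> main k x + 1 * err x"
  proof eventually_elim
    case (elim x)
    define t where "t = (ln_iter 3 x)\<^sup>2"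
    have t: "t > 0" using elim by (simp add: t_def l3)
    have main: "main k x \<ge> 0" for k
      using elim A[of k] assms by (simp add: main_def l3)
    have "ln x powr c1 > 0" using elim by auto
    then have "1 / c \<le> x / ln x powr c1" using elim assms(1) by (simp add: field_simps)
    \<comment> \<open>With \<open>t\<close> the square of the triple logarithm, the right side is
      exactly the error term, so \<open>C = 1\<close> works.\<close>
    also have "\<dots> \<le> x / ln x powr c1 * (exp t / t)"
    proof -
      have "t \<le> exp t" using exp_ge_add_one_self[of t] by linarith
      then have "1 \<le> exp t / t" using t by simp
      then show ?thesis using elim mult_left_mono[of 1 "exp t / t" "x / ln x powr c1"] by simp
    qed
    finally have err: "1 / c \<le> err x" by (simp add: err_def t_def)
    then have err0: "err x \<ge> 0" using assms
        by (meson divide_nonneg_pos less_imp_le order_trans zero_le_one)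
    show ?case
    proof (intro allI impI)
      fix k :: nat assume k: "1 \<le> k"
      show "count k x \<le> main k x + 1 * err x"
      proof (cases "k \<le> K")
        case True
        then show ?thesis using elim k err0 by force
      next
        case False
        then have "(1 / 2 :: real) ^ k \<le> (1 / 2) ^ K" by (intro power_decreasing) auto
        then have "(1 / 2) ^ k < c" using K by linarith
        then have "count k x \<le> 1 / c"
          unfolding count_def using assms(1) by (intro card_large_iterate_le_inverse)
        then show ?thesis using main[of k] err by linarith
      qed
    qed
  qed
  then show ?thesis unfolding count_def main_def A_def err_def
    by (intro exI[of _ 1] conjI) (auto elim!: eventually_mono)
qed

end
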